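(* Let $n\ge 2$, let $m\ge 1$, and let $$w=h_{n-1}(j_1,i_1)\,a_n\,h_{n-1}(j_2,i_2)\,a_n\cdots h_{n-1}(j_m,i_m)\,a_n\,x$$ be the canonical reduced expression of an element $w\in W(\tilde A_{n-1})$, where $x$ is the canonical reduced expression of an element of $W(A_{n-1})$. Substituting $\sigma_na_{n+1}\sigma_n$ for $a_n$ in this expression produces a reduced expression of $R_n(w)$, and the canonical reduced expression of $R_n(w)$ in $W(\tilde A_n)$ is $$R_n(w)=h_n(j_1,i_1)\,a_{n+1}\,h_n(j_2,i'_2)\,a_{n+1}\cdots h_n(j_m,i'_m)\,a_{n+1}\,\lfloor t,n\rfloor\,x,$$ where, letting $s=\max\{k : 1\le k\le m \text{ and } n-k-i_k>0\}$, $$i'_k=i_k\ \text{ for } k\le s,\qquad i'_k=i_k+1\ \text{ for } k>s,\qquad t=n-s+1.$$ This implies $$L(R_n(w))=L(w),\qquad l(R_n(w))=l(w)+2L(w);$$ hence replacing $a_n$ by $\sigma_na_{n+1}\sigma_n$ in a reduced expression for $w$ produces a reduced expression for $R_n(w)$ if and only if the expression for $w$ is affine length reduced.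
   Context: For $N\ge 2$, $W(\tilde A_N)$ is the affine Coxeter group with generators $S_N=\{\sigma_1,\dots,\sigma_N,a_{N+1}\}$ whose Coxeter diagram is the $(N+1)$-cycle $\sigma_1-\sigma_2-\cdots-\sigma_N-a_{N+1}-\sigma_1$ (all edges of order 3); $W(\tilde A_1)$ is the infinite dihedral group with generators $\sigma_1,a_2$. $W(A_N)$ is the parabolic subgroup generated by $\sigma_1,\dots,\sigma_N$. $l$ denotes Coxeter length (in the relevant group). The affine length $L(w)$ of $w\in W(\tilde A_N)$ is the minimal number of occurrences of $a_{N+1}$ in the reduced expressions of $w$; an affine length reduced expression of $w$ is a reduced expression with exactly $L(w)$ occurrences of $a_{N+1}$. $R_n:W(\tilde A_{n-1})\to W(\tilde A_n)$ is the (injective) group homomorphism with $\sigma_i\mapsto\sigma_i$ for $1\le i\le n-1$ and $a_n\mapsto\sigma_na_{n+1}\sigma_n$. Notation: $\lfloor i,j\rfloor=\sigma_i\sigma_{i+1}\cdots\sigma_j$ for $i\le j$, and $\lfloor j+1,j\rfloor=1$; $\lceil i,1\rceil=\sigma_i\sigma_{i-1}\cdots\sigma_1$ for $i\ge1$, and $\lceil 0,1\rceil=1$; $h_N(r,i)=\lfloor r,N\rfloor\lceil i,1\rceil$ for $0\le i\le N-1$, $1\le r\le N+1$. The canonical reduced expression of an element of $W(A_N)$ is its unique expression $\lfloor k_1,l_1\rfloor\cdots\lfloor k_t,l_t\rfloor$ with $t\ge0$, $N\ge l_1>\dots>l_t\ge1$, $l_h\ge k_h\ge1$. The canonical reduced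 expression of an element $w\in W(\tilde A_N)$ with $L(w)=m\ge1$ is its unique expression $h_N(j_1,i_1)a_{N+1}\cdots h_N(j_m,i_m)a_{N+1}\,x$ with $x$ a canonical reduced expression of an element of $W(A_N)$ and $(j_s,i_s)_{1\le s\le m}$ satisfying the pairwise inequalities (for $N$): (1) $1\le j_1\le N+1$ and $0\le i_1\le N-1$; (2) for $2\le s\le m$, either $i_s=0$ and $j_s=1$, or $1\le i_s\le N-1$ and $1\le j_s\le N$; (3) for $2\le s\le m$, $j_s\le j_{s-1}$ and $i_s\ge i_{s-1}$; (4) for $2\le s\le m$, if $j_{s-1}>i_{s-1}+1$ then $j_s<j_{s-1}$; (5) for $2\le s\le m$, if $j_s>i_s+1$ then $i_s>i_{s-1}$. *)

theory Defs
  imports "HOL-Algebra.Group"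
begin

section \<open>Coxeter groups by generators and relations\<close>

text \<open>
  The Coxeter group of a Coxeter matrix \<open>M\<close> on a generating set \<open>S\<close> is given by the presentation with
  relations \<open>(s t)^(M s t) = 1\<close>; the value \<open>M s t = 0\<close> encodes order infinity, i.e. no relation.
  Since \<open>M s s = 1\<close> makes every generator an involution, inverses of generators are not needed and the
  group is the quotient of the free monoid \<open>lists S\<close> by the congruence below.
\<close>

inductive cox_eq :: "'a set \<Rightarrow> ('a \<Rightarrow> 'a \<Rightarrow> nat) \<Rightarrow> 'a list \<Rightarrow> 'a list \<Rightarrow> bool"
  for S :: "'a set" and M :: "'a \<Rightarrow> 'a \<Rightarrow> nat" where
  refl: "u \<in> lists S \<Longrightarrow> cox_eq S M u u"
| sym: "cox_eq S M u v \<Longrightarrow> cox_eq S M v u"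
| trans: "cox_eq S M u v \<Longrightarrow> cox_eq S M v w \<Longrightarrow> cox_eq S M u w"
| rel: "u \<in> lists S \<Longrightarrow> v \<in> lists S \<Longrightarrow> s \<in> S \<Longrightarrow> t \<in> S \<Longrightarrow> M s t \<noteq> 0 \<Longrightarrow>
    cox_eq S M (u @ concat (replicate (M s t) [s, t]) @ v) (u @ v)"

definition cox_class :: "'a set \<Rightarrow> ('a \<Rightarrow> 'a \<Rightarrow> nat) \<Rightarrow> 'a list \<Rightarrow> 'a list set" where
  "cox_class S M u = {v. cox_eq S M u v}"

definition cox_group :: "'a set \<Rightarrow> ('a \<Rightarrow> 'a \<Rightarrow> nat) \<Rightarrow> 'a list set monoid" where
  "cox_group S M =
    \<lparr>carrier = cox_class S M ` lists S,
     mult = (\<lambda>X Y. \<Union>u\<in>X. \<Union>v\<in>Y. cox_class S M (u @ v)),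
     one = cox_class S M []\<rparr>"

definition cox_length :: "'a set \<Rightarrow> ('a \<Rightarrow> 'a \<Rightarrow> nat) \<Rightarrow> 'a list set \<Rightarrow> nat" where
  "cox_length S M w = (LEAST k. \<exists>u\<in>lists S. cox_class S M u = w \<and> length u = k)"


section \<open>The groups of affine type A\<close>

datatype gen = Sigma nat | Aff nat

text \<open>\<open>Sigma i\<close> is $\sigma_i$ and \<open>Aff k\<close> is $a_k$.\<close>

definition gens :: "nat \<Rightarrow> gen set" where
  "gens N = Sigma ` {1..N} \<union> {Aff (N + 1)}"

definition linked :: "nat \<Rightarrow> gen \<Rightarrow> gen \<Rightarrow> bool" where
  "linked N s t \<longleftrightarrow>
    (\<exists>i\<in>{1..<N}. {s, t} = {Sigma i, Sigma (i + 1)}) \<or>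
    {s, t} = {Sigma N, Aff (N + 1)} \<or> {s, t} = {Aff (N + 1), Sigma 1}"

text \<open>For \<open>N = 1\<close> the product of the two generators has infinite order (infinite dihedral group).\<close>

definition cox_mat :: "nat \<Rightarrow> gen \<Rightarrow> gen \<Rightarrow> nat" where
  "cox_mat N s t = (if s = t then 1 else if N = 1 then 0 else if linked N s t then 3 else 2)"

definition W_aff :: "nat \<Rightarrow> gen list set monoid" where
  "W_aff N = cox_group (gens N) (cox_mat N)"

definition elt :: "nat \<Rightarrow> gen list \<Rightarrow> gen list set" where
  "elt N u = cox_class (gens N) (cox_mat N) u"

definition len :: "nat \<Rightarrow> gen list set \<Rightarrow> nat" where
  "len N w = cox_length (gens N) (cox_mat N) w"

definition expression :: "nat \<Rightarrow> gen list \<Rightarrow> gen list set \<Rightarrow> bool" where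
  "expression N u w \<longleftrightarrow> u \<in> lists (gens N) \<and> elt N u = w"

definition reduced_expr :: "nat \<Rightarrow> gen list \<Rightarrow> gen list set \<Rightarrow> bool" where
  "reduced_expr N u w \<longleftrightarrow> expression N u w \<and> length u = len N w"

definition affine_length :: "nat \<Rightarrow> gen list set \<Rightarrow> nat" where
  "affine_length N w = (LEAST k. \<exists>u. reduced_expr N u w \<and> count_list u (Aff (N + 1)) = k)"

definition affine_length_reduced_expr :: "nat \<Rightarrow> gen list \<Rightarrow> gen list set \<Rightarrow> bool" where
  "affine_length_reduced_expr N u w \<longleftrightarrow>
    reduced_expr N u w \<and> count_list u (Aff (N + 1)) = affine_length N w"


section \<open>Canonical reduced expressions\<close>

text \<open>\<open>up i j\<close> is $\lfloor i,j\rfloor$, the empty word for \<open>i = j + 1\<close>; \<open>down i\<close> is $\lceil i,1\rceil$.\<close>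

definition up :: "nat \<Rightarrow> nat \<Rightarrow> gen list" where
  "up i j = map Sigma [i..<j + 1]"

definition down :: "nat \<Rightarrow> gen list" where
  "down i = map Sigma (rev [1..<i + 1])"

definition h_word :: "nat \<Rightarrow> nat \<Rightarrow> nat \<Rightarrow> gen list" where
  "h_word N r i = up r N @ down i"

definition canonical_A :: "nat \<Rightarrow> gen list \<Rightarrow> bool" where
  "canonical_A N x \<longleftrightarrow>
    (\<exists>t k l. (\<forall>p\<in>{1..t}. 1 \<le> k p \<and> k p \<le> l p \<and> l p \<le> N) \<and>
             (\<forall>p\<in>{1..<t}. l p > l (p + 1)) \<and>
             x = concat (map (\<lambda>p. up (k p) (l p)) [1..<t + 1]))"

definition pairwise_ineqs :: "nat \<Rightarrow> nat \<Rightarrow> (nat \<Rightarrow> nat) \<Rightarrow> (nat \<Rightarrow> nat) \<Rightarrow> bool" where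
  "pairwise_ineqs N m j i \<longleftrightarrow>
    (1 \<le> j 1 \<and> j 1 \<le> N + 1 \<and> i 1 + 1 \<le> N) \<and>
    (\<forall>s\<in>{2..m}. (i s = 0 \<and> j s = 1) \<or> (1 \<le> i s \<and> i s + 1 \<le> N \<and> 1 \<le> j s \<and> j s \<le> N)) \<and>
    (\<forall>s\<in>{2..m}. j s \<le> j (s - 1) \<and> i s \<ge> i (s - 1)) \<and>
    (\<forall>s\<in>{2..m}. j (s - 1) > i (s - 1) + 1 \<longrightarrow> j s < j (s - 1)) \<and>
    (\<forall>s\<in>{2..m}. j s > i s + 1 \<longrightarrow> i s > i (s - 1))"

definition canonical_word :: "nat \<Rightarrow> nat \<Rightarrow> (nat \<Rightarrow> nat) \<Rightarrow> (nat \<Rightarrow> nat) \<Rightarrow> gen list \<Rightarrow> gen list" where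
  "canonical_word N m j i x = concat (map (\<lambda>s. h_word N (j s) (i s) @ [Aff (N + 1)]) [1..<m + 1]) @ x"

definition canonical_form :: "nat \<Rightarrow> nat \<Rightarrow> (nat \<Rightarrow> nat) \<Rightarrow> (nat \<Rightarrow> nat) \<Rightarrow> gen list \<Rightarrow> bool" where
  "canonical_form N m j i x \<longleftrightarrow> m \<ge> 1 \<and> pairwise_ineqs N m j i \<and> canonical_A N x"

text \<open>
  That every element has exactly one expression in canonical form, that this expression is reduced and
  that \<open>m\<close> is the affine length are known facts. Reducedness and the value of the affine length
  are recorded in the following predicate, so that it can be used as a conclusion; a word in canonical
  form suffices as a hypothesis.
\<close>

definition canonical_reduced_expr ::
    "nat \<Rightarrow> nat \<Rightarrow> (nat \<Rightarrow> nat) \<Rightarrow> (nat \<Rightarrow> nat) \<Rightarrow> gen list \<Rightarrow> gen list set \<Rightarrow> bool" where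
  "canonical_reduced_expr N m j i x w \<longleftrightarrow>
    canonical_form N m j i x \<and> reduced_expr N (canonical_word N m j i x) w \<and> affine_length N w = m"


section \<open>The homomorphism from rank \<open>n\<close> to rank \<open>n + 1\<close>\<close>

definition subst_aff :: "nat \<Rightarrow> gen list \<Rightarrow> gen list" where
  "subst_aff n u =
    concat (map (\<lambda>s. if s = Aff n then [Sigma n, Aff (n + 1), Sigma n] else [s]) u)"

text \<open>
  \<open>R_map n\<close> sends the class of a word to the class of the substituted word. By \<open>R_map_hom\<close>,
  \<open>R_map_Sigma\<close> and \<open>R_map_Aff\<close> below this is the homomorphism determined by its values on the
  generators.
\<close>

definition R_map :: "nat \<Rightarrow> gen list set \<Rightarrow> gen list set" where
  "R_map n w = (\<Union>u\<in>w. elt n (subst_aff n u))"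

lemma cox_eq_lists: "cox_eq S M u v \<Longrightarrow> u \<in> lists S \<and> v \<in> lists S"
proof (induction rule: cox_eq.induct)
  case (rel u v s t)
  have "concat (replicate k [s, t]) \<in> lists S" for k
    using rel by (induction k) auto
  then show ?case using rel by simp
qed auto

lemma cox_eq_ctxt:
  assumes "cox_eq S M u v" "p \<in> lists S" "q \<in> lists S"
  shows "cox_eq S M (p @ u @ q) (p @ v @ q)"
  using assms
proof (induction rule: cox_eq.induct)
  case (refl u)
  then show ?case by (intro cox_eq.refl) simp
next
  case (sym u v)
  then show ?case by (blast intro: cox_eq.sym)
next
  case (trans u v w)
  then show ?case by (blast intro: cox_eq.trans)
next
  case (rel u v s t)
  then have "p @ u \<in> lists S" "v @ q \<in> lists S" by auto
  from cox_eq.rel[where M = M, OF this rel(3-5)] show ?case by simp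
qed

lemma cox_eq_append:
  assumes "cox_eq S M u u'" "cox_eq S M v v'"
  shows "cox_eq S M (u @ v) (u' @ v')"
proof -
  have "cox_eq S M (u @ v) (u' @ v)"
    using cox_eq_ctxt[OF assms(1), of "[]" v] cox_eq_lists[OF assms(2)] by simp
  moreover have "cox_eq S M (u' @ v) (u' @ v')"
    using cox_eq_ctxt[OF assms(2), of u' "[]"] cox_eq_lists[OF assms(1)] by simp
  ultimately show ?thesis by (rule cox_eq.trans)
qed

lemma cox_class_eq_iff:
  "u \<in> lists S \<Longrightarrow> cox_class S M u = cox_class S M v \<longleftrightarrow> cox_eq S M u v"
  unfolding cox_class_def by (blast intro: cox_eq.refl cox_eq.sym cox_eq.trans)

lemma cox_group_mult:
  assumes u: "u \<in> lists S" and v: "v \<in> lists S"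
  shows "cox_class S M u \<otimes>\<^bsub>cox_group S M\<^esub> cox_class S M v = cox_class S M (u @ v)"
proof -
  have uv: "u @ v \<in> lists S" using u v by simp
  have "cox_class S M (u' @ v') = cox_class S M (u @ v)"
    if "u' \<in> cox_class S M u" "v' \<in> cox_class S M v" for u' v'
  proof -
    have "cox_eq S M (u @ v) (u' @ v')"
      using that by (intro cox_eq_append) (simp_all add: cox_class_def)
    then show ?thesis using cox_class_eq_iff[OF uv, of M "u' @ v'"] by blast
  qed
  moreover have "u \<in> cox_class S M u" "v \<in> cox_class S M v"
    using cox_eq.refl[OF u, of M] cox_eq.refl[OF v, of M] by (simp_all add: cox_class_def)
  ultimately have "(\<Union>u'\<in>cox_class S M u. \<Union>v'\<in>cox_class S M v. cox_class S M (u' @ v'))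
      = cox_class S M (u @ v)" by blast
  then show ?thesis by (simp add: cox_group_def)
qed

lemma cox_eq_rev:
  assumes sq: "\<And>s. s \<in> S \<Longrightarrow> M s s = 1" and "u \<in> lists S"
  shows "cox_eq S M (rev u @ u) []"
  using assms(2)
proof (induction u)
  case Nil
  then show ?case using cox_eq.refl[of "[]" S M] by simp
next
  case (Cons s u)
  have "rev u \<in> lists S" using Cons(2) by auto
  then have "cox_eq S M (rev u @ concat (replicate (M s s) [s, s]) @ u) (rev u @ u)"
    using Cons sq[of s] by (intro cox_eq.rel) simp_all
  then have "cox_eq S M (rev (s # u) @ s # u) (rev u @ u)"
    using Cons sq[of s] by simp
  then show ?case using Cons(3) by (rule cox_eq.trans)
qed

lemma cox_group_is_group:
  assumes sq: "\<And>s. s \<in> S \<Longrightarrow> M s s = 1"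
  shows "group (cox_group S M)"
proof -
  have carr: "carrier (cox_group S M) = cox_class S M ` lists S"
    and one: "\<one>\<^bsub>cox_group S M\<^esub> = cox_class S M []"
    by (simp_all add: cox_group_def)
  show ?thesis
  proof (rule groupI, goal_cases)
    case (1 x y)
    then obtain u v where "u \<in> lists S" "v \<in> lists S"
      "x = cox_class S M u" "y = cox_class S M v"
      unfolding carr by blast
    moreover from this have "u @ v \<in> lists S" by simp
    ultimately show ?case unfolding carr by (metis cox_group_mult imageI)
  next
    case 2
    show ?case unfolding carr one by blast
  next
    case (3 x y z)
    then obtain u v w where "u \<in> lists S" "v \<in> lists S" "w \<in> lists S"
      "x = cox_class S M u" "y = cox_class S M v" "z = cox_class S M w"
      unfolding carr by blast
    then show ?case by (simp add: cox_group_mult)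
  next
    case (4 x)
    then obtain u where "u \<in> lists S" "x = cox_class S M u" unfolding carr by blast
    then show ?case using cox_group_mult[of "[]" S u M] by (simp add: one)
  next
    case (5 x)
    then obtain u where u: "u \<in> lists S" "x = cox_class S M u" unfolding carr by blast
    then have ru: "rev u \<in> lists S" "rev u @ u \<in> lists S" by auto
    have "cox_class S M (rev u @ u) = cox_class S M []"
      using cox_eq_rev[of S M u] sq u(1) cox_class_eq_iff[OF ru(2), of M "[]"] by blast
    then have "cox_class S M (rev u) \<otimes>\<^bsub>cox_group S M\<^esub> x = \<one>\<^bsub>cox_group S M\<^esub>"
      using u ru by (simp only: cox_group_mult one)
    then show ?case using ru(1) unfolding carr by blast
  qed
qed

lemma W_group: "group (W_aff N)"
  unfolding W_aff_def by (rule cox_group_is_group) (simp add: cox_mat_def)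

lemma W_carrier: "carrier (W_aff N) = elt N ` lists (gens N)"
  by (simp add: W_aff_def cox_group_def elt_def[abs_def])

lemma W_mult:
  "u \<in> lists (gens N) \<Longrightarrow> v \<in> lists (gens N) \<Longrightarrow> elt N u \<otimes>\<^bsub>W_aff N\<^esub> elt N v = elt N (u @ v)"
  by (simp add: W_aff_def elt_def cox_group_mult)

lemma W_one: "\<one>\<^bsub>W_aff N\<^esub> = elt N []"
  by (simp add: W_aff_def cox_group_def elt_def)

lemma elt_eq_iff:
  "u \<in> lists (gens N) \<Longrightarrow> elt N u = elt N v \<longleftrightarrow> cox_eq (gens N) (cox_mat N) u v"
  by (simp add: elt_def cox_class_eq_iff)

lemma subst_aff_append: "subst_aff n (u @ v) = subst_aff n u @ subst_aff n v"
  by (simp add: subst_aff_def)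

lemma subst_aff_lists:
  assumes "n \<ge> 2" "u \<in> lists (gens (n - 1))"
  shows "subst_aff n u \<in> lists (gens n)"
  using assms(2)
proof (induction u)
  case (Cons s u)
  then show ?case using assms(1) by (auto simp: subst_aff_def gens_def)
qed (simp add: subst_aff_def)

lemma elt_sq:
  assumes "s \<in> gens N" shows "elt N [s, s] = \<one>\<^bsub>W_aff N\<^esub>"
proof -
  have "cox_eq (gens N) (cox_mat N) ([] @ concat (replicate (cox_mat N s s) [s, s]) @ []) ([] @ [])"
    using assms by (intro cox_eq.rel) (auto simp: cox_mat_def)
  then show ?thesis using assms by (simp add: cox_mat_def W_one elt_eq_iff)
qed

lemma elt_pow:
  assumes "u \<in> lists (gens N)"
  shows "elt N u [^]\<^bsub>W_aff N\<^esub> (k::nat) = elt N (concat (replicate k u))"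
proof (induction k)
  case 0
  interpret group "W_aff N" by (rule W_group)
  show ?case by (simp add: W_one)
next
  case (Suc k)
  interpret group "W_aff N" by (rule W_group)
  have "concat (replicate k u) \<in> lists (gens N)" using assms by (induction k) auto
  moreover have "concat (replicate k u) @ u = concat (replicate (Suc k) u)"
    by (induction k) auto
  ultimately show ?case using Suc assms by (simp add: W_mult)
qed

lemma elt_rel:
  assumes "s \<in> gens N" "t \<in> gens N"
  shows "elt N [s, t] [^]\<^bsub>W_aff N\<^esub> (cox_mat N s t) = \<one>\<^bsub>W_aff N\<^esub>"
proof (cases "cox_mat N s t = 0")
  case True
  interpret group "W_aff N" by (rule W_group)
  show ?thesis using True by simp
next
  case False
  have "cox_eq (gens N) (cox_mat N) ([] @ concat (replicate (cox_mat N s t) [s, t]) @ []) ([] @ [])"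
    using assms False by (intro cox_eq.rel) auto
  moreover have "concat (replicate k [s, t]) \<in> lists (gens N)" for k
    using assms by (induction k) auto
  ultimately show ?thesis using assms by (simp add: elt_pow W_one elt_eq_iff)
qed


lemma elt_closed [simp]: "u \<in> lists (gens N) \<Longrightarrow> elt N u \<in> carrier (W_aff N)"
  by (simp only: W_carrier imageI)

lemma elt_rev:
  assumes "u \<in> lists (gens N)"
  shows "elt N (rev u) = inv\<^bsub>W_aff N\<^esub> (elt N u)"
proof -
  interpret group "W_aff N" by (rule W_group)
  have r: "rev u \<in> lists (gens N)" "rev u @ u \<in> lists (gens N)" using assms by auto
  have "cox_eq (gens N) (cox_mat N) (rev u @ u) []"
    using assms by (intro cox_eq_rev) (simp_all add: cox_mat_def)
  then have "elt N (rev u) \<otimes>\<^bsub>W_aff N\<^esub> elt N u = \<one>\<^bsub>W_aff N\<^esub>"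
    using W_mult[OF r(1) assms] elt_eq_iff[OF r(2)] by (simp only: W_one)
  then show ?thesis using r assms elt_closed by (metis inv_equality)
qed

lemma elt_pow_conj:
  assumes c: "c \<in> gens N" and u: "u \<in> lists (gens N)"
    and k: "elt N u [^]\<^bsub>W_aff N\<^esub> (k::nat) = \<one>\<^bsub>W_aff N\<^esub>"
  shows "elt N (c # u @ [c]) [^]\<^bsub>W_aff N\<^esub> k = \<one>\<^bsub>W_aff N\<^esub>"
proof -
  interpret group "W_aff N" by (rule W_group)
  let ?c = "elt N [c]" and ?u = "elt N u"
  have cc: "?c \<in> carrier (W_aff N)" "?u \<in> carrier (W_aff N)"
    using c u by simp_all
  have sq: "?c \<otimes>\<^bsub>W_aff N\<^esub> ?c = \<one>\<^bsub>W_aff N\<^esub>"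
    using c elt_sq[OF c] W_mult[of "[c]" N "[c]"] by simp
  have "elt N (c # u @ [c]) = ?c \<otimes>\<^bsub>W_aff N\<^esub> ?u \<otimes>\<^bsub>W_aff N\<^esub> ?c"
    using c u by (simp add: W_mult)
  moreover have "(?c \<otimes>\<^bsub>W_aff N\<^esub> ?u \<otimes>\<^bsub>W_aff N\<^esub> ?c) [^]\<^bsub>W_aff N\<^esub> k
      = ?c \<otimes>\<^bsub>W_aff N\<^esub> (?u [^]\<^bsub>W_aff N\<^esub> k) \<otimes>\<^bsub>W_aff N\<^esub> ?c" for k :: nat
  proof (induction k)
    case 0
    then show ?case using cc sq by simp
  next
    case (Suc k)
    have "?c \<otimes>\<^bsub>W_aff N\<^esub> (?u [^]\<^bsub>W_aff N\<^esub> k) \<otimes>\<^bsub>W_aff N\<^esub> ?c \<otimes>\<^bsub>W_aff N\<^esub> (?c \<otimes>\<^bsub>W_aff N\<^esub> ?u \<otimes>\<^bsub>W_aff N\<^esub> ?c)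
      = ?c \<otimes>\<^bsub>W_aff N\<^esub> (?u [^]\<^bsub>W_aff N\<^esub> k) \<otimes>\<^bsub>W_aff N\<^esub> (?c \<otimes>\<^bsub>W_aff N\<^esub> ?c) \<otimes>\<^bsub>W_aff N\<^esub> (?u \<otimes>\<^bsub>W_aff N\<^esub> ?c)"
      using cc by (simp only: m_assoc m_closed nat_pow_closed)
    also have "\<dots> = ?c \<otimes>\<^bsub>W_aff N\<^esub> (?u [^]\<^bsub>W_aff N\<^esub> Suc k) \<otimes>\<^bsub>W_aff N\<^esub> ?c"
      unfolding sq using cc by (simp add: m_assoc)
    finally show ?case using Suc by simp
  qed
  ultimately show ?thesis using k cc sq by simp
qed

lemma elt_ctxt:
  assumes "elt N u = elt N v"
    and "u \<in> lists (gens N)" "v \<in> lists (gens N)" "p \<in> lists (gens N)" "q \<in> lists (gens N)"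
  shows "elt N (p @ u @ q) = elt N (p @ v @ q)"
proof -
  have "u @ q \<in> lists (gens N)" "v @ q \<in> lists (gens N)" using assms by simp_all
  then show ?thesis
    using W_mult[OF assms(4), of "u @ q"] W_mult[OF assms(4), of "v @ q"]
      W_mult[OF assms(2,5)] W_mult[OF assms(3,5)] assms(1) by simp
qed

lemma elt_comm:
  assumes s: "s \<in> gens N" and t: "t \<in> gens N" and "cox_mat N s t = 2"
  shows "elt N [s, t] = elt N [t, s]"
proof -
  interpret group "W_aff N" by (rule W_group)
  have st: "[s, t] \<in> lists (gens N)" using s t by simp
  have "elt N [s, t] \<otimes>\<^bsub>W_aff N\<^esub> elt N [s, t] = \<one>\<^bsub>W_aff N\<^esub>"
    using elt_rel[OF s t] assms(3) elt_closed[OF st] by (simp add: numeral_2_eq_2)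
  then have "inv\<^bsub>W_aff N\<^esub> (elt N [s, t]) = elt N [s, t]"
    using elt_closed[OF st] by (intro inv_equality)
  then show ?thesis using elt_rev[OF st] by simp
qed

lemma elt_braid:
  assumes s: "s \<in> gens N" and t: "t \<in> gens N" and "cox_mat N s t = 3"
  shows "elt N [s, t, s] = elt N [t, s, t]"
proof -
  interpret group "W_aff N" by (rule W_group)
  have l: "[s, t, s] \<in> lists (gens N)" "[t, s, t] \<in> lists (gens N)" "[s, t] \<in> lists (gens N)"
    using s t by simp_all
  have "elt N [s, t] [^]\<^bsub>W_aff N\<^esub> (3::nat) = \<one>\<^bsub>W_aff N\<^esub>"
    using elt_rel[OF s t] assms(3) by simp
  then have "elt N [s, t, s] \<otimes>\<^bsub>W_aff N\<^esub> elt N [t, s, t] = \<one>\<^bsub>W_aff N\<^esub>"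
    using W_mult[OF l(1,2)] elt_pow[OF l(3), of 3] by (simp add: numeral_3_eq_3)
  then have "inv\<^bsub>W_aff N\<^esub> (elt N [t, s, t]) = elt N [s, t, s]"
    using l elt_closed by (metis inv_equality)
  then show ?thesis using elt_rev[OF l(2)] by simp
qed

lemma cox_mat_sym: "cox_mat N s t = cox_mat N t s"
  by (auto simp: cox_mat_def linked_def insert_commute)

lemma subst_rel_Sigma_Aff:
  assumes n: "n \<ge> 3" and k: "1 \<le> k" "k \<le> n - 1"
  shows "elt n (subst_aff n [Sigma k, Aff n]) [^]\<^bsub>W_aff n\<^esub> (cox_mat (n - 1) (Sigma k) (Aff n))
    = \<one>\<^bsub>W_aff n\<^esub>"
proof -
  let ?x = "Sigma k" and ?s = "Sigma n" and ?a = "Aff (n + 1)"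
  have g: "?x \<in> gens n" "?s \<in> gens n" "?a \<in> gens n" using n k by (auto simp: gens_def)
  have sub: "subst_aff n [Sigma k, Aff n] = [?x, ?s, ?a, ?s]" by (simp add: subst_aff_def)
  show ?thesis
  proof (cases "k = n - 1")
    case True
    have m: "cox_mat (n - 1) (Sigma k) (Aff n) = 3" "cox_mat n ?x ?s = 3" "cox_mat n ?s ?a = 3"
        "cox_mat n ?x ?a = 2"
      using n True by (auto simp: cox_mat_def linked_def doubleton_eq_iff)
    have "elt n [?x, ?s, ?a, ?s] = elt n [?x, ?a, ?s, ?a]"
      using elt_ctxt[OF elt_braid[OF g(2,3) m(3)], of "[?x]" "[]"] g by simp
    also have "\<dots> = elt n [?a, ?x, ?s, ?a]"
      using elt_ctxt[OF elt_comm[OF g(1,3) m(4)], of "[]" "[?s, ?a]"] g by simp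
    finally show ?thesis
      using elt_pow_conj[OF g(3), of "[?x, ?s]" 3] elt_rel[OF g(1,2)] g m sub by simp
  next
    case False
    have m: "cox_mat (n - 1) (Sigma k) (Aff n) = cox_mat n ?x ?a" "cox_mat n ?x ?s = 2"
      using n k False by (auto simp: cox_mat_def linked_def doubleton_eq_iff)
    have "elt n [?x, ?s, ?a, ?s] = elt n [?s, ?x, ?a, ?s]"
      using elt_ctxt[OF elt_comm[OF g(1,2) m(2)], of "[]" "[?a, ?s]"] g by simp
    then show ?thesis
      using elt_pow_conj[OF g(2), of "[?x, ?a]" "cox_mat n ?x ?a"] elt_rel[OF g(1,3)] g m sub by simp
  qed
qed

lemma subst_rel:
  assumes n: "n \<ge> 2" and s: "s \<in> gens (n - 1)" and t: "t \<in> gens (n - 1)"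
  shows "elt n (subst_aff n [s, t]) [^]\<^bsub>W_aff n\<^esub> (cox_mat (n - 1) s t) = \<one>\<^bsub>W_aff n\<^esub>"
proof -
  interpret group "W_aff n" by (rule W_group)
  have st: "[s, t] \<in> lists (gens (n - 1))" using s t by simp
  have sub: "subst_aff n [s, t] \<in> lists (gens n)" using subst_aff_lists[OF n st] .
  have cases: "(\<exists>k. s = Sigma k \<and> 1 \<le> k \<and> k \<le> n - 1) \<or> s = Aff n"
      "(\<exists>k. t = Sigma k \<and> 1 \<le> k \<and> k \<le> n - 1) \<or> t = Aff n"
    using s t n by (auto simp: gens_def)
  consider "s = t" | "s \<noteq> t" "n = 2" | k l where "s \<noteq> t" "n \<ge> 3" "s = Sigma k" "t = Sigma l"
    | k where "n \<ge> 3" "1 \<le> k" "k \<le> n - 1" "s = Sigma k" "t = Aff n"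
    | k where "n \<ge> 3" "1 \<le> k" "k \<le> n - 1" "s = Aff n" "t = Sigma k"
    using cases n by (cases "n = 2") auto
  then show ?thesis
  proof cases
    case 1
    have r: "rev (subst_aff n [s]) = subst_aff n [s]" by (simp add: subst_aff_def)
    have l: "subst_aff n [s] \<in> lists (gens n)" using subst_aff_lists[OF n, of "[s]"] s by simp
    have "elt n (subst_aff n [s, t]) = elt n (subst_aff n [s]) \<otimes>\<^bsub>W_aff n\<^esub> elt n (subst_aff n [s])"
      using 1 W_mult[OF l l] subst_aff_append[of n "[s]" "[s]"] by simp
    also have "\<dots> = \<one>\<^bsub>W_aff n\<^esub>"
      using elt_rev[OF l] r elt_closed[OF l] by (metis r_inv)
    finally show ?thesis by simp
  next
    case 2
    then show ?thesis by (simp add: cox_mat_def)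
  next
    case (3 k l)
    have "subst_aff n [s, t] = [s, t]" using 3 by (simp add: subst_aff_def)
    moreover have "cox_mat (n - 1) s t = cox_mat n s t"
      using 3 s t by (auto simp: cox_mat_def linked_def gens_def doubleton_eq_iff)
    moreover have "s \<in> gens n" "t \<in> gens n" using 3 s t by (auto simp: gens_def)
    ultimately show ?thesis using elt_rel by simp
  next
    case (4 k)
    then show ?thesis using subst_rel_Sigma_Aff by simp
  next
    case (5 k)
    have "subst_aff n [s, t] = rev (subst_aff n [t, s])"
      using 5 by (simp add: subst_aff_def)
    moreover have ts: "subst_aff n [t, s] \<in> lists (gens n)"
      using subst_aff_lists[OF n, of "[t, s]"] s t by simp
    ultimately have "elt n (subst_aff n [s, t]) = inv\<^bsub>W_aff n\<^esub> (elt n (subst_aff n [t, s]))"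
      using elt_rev by simp
    then show ?thesis
      using subst_rel_Sigma_Aff[OF 5(1-3)] 5(4,5) elt_closed[OF ts] cox_mat_sym[of "n - 1" s t]
      by (simp add: nat_pow_inv del: elt_closed)
  qed
qed

lemma subst_cong:
  assumes n: "n \<ge> 2" and "cox_eq (gens (n - 1)) (cox_mat (n - 1)) u v"
  shows "elt n (subst_aff n u) = elt n (subst_aff n v)"
  using assms(2)
proof (induction rule: cox_eq.induct)
  case (rel u v s t)
  let ?k = "cox_mat (n - 1) s t"
  have st: "subst_aff n [s, t] \<in> lists (gens n)"
    using rel subst_aff_lists[OF n, of "[s, t]"] by simp
  have sub: "subst_aff n (concat (replicate k [s, t])) = concat (replicate k (subst_aff n [s, t]))"
    for k by (induction k) (simp_all add: subst_aff_def)
  have l: "concat (replicate k (subst_aff n [s, t])) \<in> lists (gens n)" for k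
    using st by (induction k) simp_all
  have "elt n (concat (replicate ?k (subst_aff n [s, t]))) = elt n []"
    using elt_pow[OF st] subst_rel[OF n rel(3,4)] by (simp add: W_one)
  from elt_ctxt[OF this l, of "subst_aff n u" "subst_aff n v"] show ?case
    using subst_aff_lists[OF n rel(1)] subst_aff_lists[OF n rel(2)]
    by (simp add: subst_aff_append sub)
qed simp_all

lemma R_map_elt:
  assumes "n \<ge> 2" and "u \<in> lists (gens (n - 1))"
  shows "R_map n (elt (n - 1) u) = elt n (subst_aff n u)"
proof -
  have "u \<in> elt (n - 1) u"
    using cox_eq.refl[OF assms(2)] by (simp add: elt_def cox_class_def)
  moreover have "elt n (subst_aff n v) = elt n (subst_aff n u)" if "v \<in> elt (n - 1) u" for v
    using subst_cong[OF assms(1), of u v] that by (simp add: elt_def cox_class_def)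
  ultimately show ?thesis unfolding R_map_def by blast
qed

lemma R_map_hom:
  assumes n: "n \<ge> 2"
  shows "R_map n \<in> hom (W_aff (n - 1)) (W_aff n)"
proof (rule homI)
  fix x assume "x \<in> carrier (W_aff (n - 1))"
  then obtain u where "u \<in> lists (gens (n - 1))" "x = elt (n - 1) u" unfolding W_carrier by blast
  then show "R_map n x \<in> carrier (W_aff n)"
    using R_map_elt[OF n] elt_closed[OF subst_aff_lists[OF n]] by simp
next
  fix x y assume "x \<in> carrier (W_aff (n - 1))" "y \<in> carrier (W_aff (n - 1))"
  then obtain u v where uv: "u \<in> lists (gens (n - 1))" "x = elt (n - 1) u"
      "v \<in> lists (gens (n - 1))" "y = elt (n - 1) v" unfolding W_carrier by blast
  then have "u @ v \<in> lists (gens (n - 1))" by simp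
  then show "R_map n (x \<otimes>\<^bsub>W_aff (n - 1)\<^esub> y) = R_map n x \<otimes>\<^bsub>W_aff n\<^esub> R_map n y"
    using uv subst_aff_lists[OF n] R_map_elt[OF n] W_mult
    by (simp only: subst_aff_append)
qed

lemma R_map_Sigma:
  "n \<ge> 2 \<Longrightarrow> 1 \<le> i \<Longrightarrow> i \<le> n - 1 \<Longrightarrow> R_map n (elt (n - 1) [Sigma i]) = elt n [Sigma i]"
  by (subst R_map_elt) (auto simp: gens_def subst_aff_def)

lemma R_map_Aff:
  "n \<ge> 2 \<Longrightarrow> R_map n (elt (n - 1) [Aff n]) = elt n [Sigma n, Aff (n + 1), Sigma n]"
  by (subst R_map_elt) (auto simp: gens_def subst_aff_def)

end

theory Submission
  imports Defs
begin

text \<open>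
  There are two independent halves: canonical words are reduced and realise the affine length, and
  the substituted word can be brought into canonical form by braid moves alone.

  For the first half, let the group act on integer vectors $(y_1,\dots,y_{N+1})$: $\sigma_k$ swaps
  two neighbouring entries, and $a_{N+1}$ swaps the two ends while raising the new first entry and
  lowering the new last one by $N+1$. Two statistics give lower bounds. Shi's sum
  $\sum_{p<q}\bigl|\lfloor (y_p-y_q)/(N+1)\rfloor\bigr|$ changes by at most one per letter, and
  $\sum_p\max(0,\lfloor y_p/(N+1)\rfloor)$ is invariant under every $\sigma_k$ and grows by at most
  one per $a_{N+1}$. A word in which each letter, read from the right, attains both bounds is
  therefore shortest among all expressions of its element and has the fewest letters $a_{N+1}$
  (\<open>ascending_reduced\<close>). Canonical words have this property (\<open>ascending_canonical_word\<close>). The part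
  in $W(A_N)$ sorts entries of one period. After that each letter $a_{N+1}$ creates a large first
  entry and a negative last entry, and the following $h_N(j,i)$ drags the first to the right past
  $i$ entries and the last to the left up to place $j$. The pairwise inequalities keep everything
  left of the large entry below $N+1$ and everything right of the negative entry nonnegative, so no
  drag ever meets an entry on the wrong side of it.

  For the second half, write each substituted block as $h_{n-1}(j,i)\,\sigma_n a_{n+1}\sigma_n$. The
  trailing $\sigma_n$ is collected in a tail $\lfloor p+1,n\rfloor$, which is moved to the right
  across the next block. While $k+i_k<n$ the tail commutes past $\lceil i_k,1\rceil$ and grows by one
  letter (\<open>block_low\<close>). As soon as $i_k$ is large, one letter of the tail is absorbed, extending
  $\lceil i_k,1\rceil$ to $\lceil i_k+1,1\rceil$, and the length of the tail no longer changes
  (\<open>block_high\<close>). These moves preserve the number of letters, so the substituted word has the length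
  of a canonical word for $n$ and is reduced. Any expression $u$ of $w$ turns into a word of length
  $l(u)+2\cdot\#\{a_n\mbox{ in }u\}$, from which the equivalence at the end can be read off.
\<close>

section \<open>The action on windows\<close>

text \<open>
  A \<^emph>\<open>window\<close> is a function that matters only at the places $1,\dots,N+1$. It lists the values of an
  affine permutation, that is of a bijection of the integers commuting with the shift by $N+1$, and
  generators act on places. Words act from the right end, as in \<open>foldr\<close>.
\<close>

definition act :: "nat \<Rightarrow> gen \<Rightarrow> (nat \<Rightarrow> int) \<Rightarrow> nat \<Rightarrow> int" where
  "act N g y = (case g of
      Sigma k \<Rightarrow> y(k := y (k + 1), k + 1 := y k)
    | Aff _ \<Rightarrow> y(1 := y (N + 1) + int (N + 1), N + 1 := y 1 - int (N + 1)))"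

abbreviation word_act :: "nat \<Rightarrow> gen list \<Rightarrow> (nat \<Rightarrow> int) \<Rightarrow> nat \<Rightarrow> int" where
  "word_act N \<equiv> foldr (act N)"

lemma act_involution:
  assumes "N \<ge> 1" "s \<in> gens N"
  shows "act N s (act N s y) = y"
  using assms by (auto simp: gens_def act_def fun_eq_iff)

lemma act_commute:
  assumes N: "N \<ge> 2" and st: "s \<in> gens N" "t \<in> gens N" "\<not> linked N s t"
  shows "act N s (act N t y) = act N t (act N s y)"
proof -
  have Sig: "act N (Sigma k) (act N (Sigma l) y) = act N (Sigma l) (act N (Sigma k) y)"
    if "k + 1 \<noteq> l" "l + 1 \<noteq> k" for k l
    using that by (cases "k = l") (auto simp: act_def fun_eq_iff)
  have Aff: "act N (Sigma k) (act N (Aff (N + 1)) y) = act N (Aff (N + 1)) (act N (Sigma k) y)"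
    if "1 < k" "k < N" for k
    using that by (auto simp: act_def fun_eq_iff)
  show ?thesis
  proof (cases s; cases t)
    fix k l assume kl: "s = Sigma k" "t = Sigma l"
    then have "k + 1 \<noteq> l" "l + 1 \<noteq> k" using st by (auto simp: gens_def linked_def)
    then show ?thesis using Sig kl by blast
  next
    fix k b assume k: "s = Sigma k" "t = Aff b"
    then have "b = N + 1" "1 \<le> k" "k \<le> N" "k \<noteq> 1" "k \<noteq> N"
      using st by (auto simp: gens_def linked_def doubleton_eq_iff)
    then show ?thesis using Aff[of k] k by simp
  next
    fix k b assume k: "s = Aff b" "t = Sigma k"
    then have "b = N + 1" "1 \<le> k" "k \<le> N" "k \<noteq> 1" "k \<noteq> N"
      using st by (auto simp: gens_def linked_def doubleton_eq_iff)
    then show ?thesis using Aff[of k] k by simp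
  next
    fix b c assume "s = Aff b" "t = Aff c"
    then have "s = t" using st by (auto simp: gens_def)
    then show ?thesis by simp
  qed
qed

lemma act_braid:
  assumes "N \<ge> 2" "s \<in> gens N" "t \<in> gens N" "linked N s t"
  shows "act N s (act N t (act N s y)) = act N t (act N s (act N t y))"
  using assms
  by (auto simp: act_def fun_eq_iff linked_def doubleton_eq_iff)

lemma word_act_relation:
  assumes N: "N \<ge> 1" and st: "s \<in> gens N" "t \<in> gens N" "cox_mat N s t \<noteq> 0"
  shows "word_act N (concat (replicate (cox_mat N s t) [s, t])) y = y"
proof -
  consider "s = t" | "N \<ge> 2" "s \<noteq> t" "linked N s t" | "N \<ge> 2" "s \<noteq> t" "\<not> linked N s t"
    using N st(3) by (force simp: cox_mat_def split: if_splits)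
  then show ?thesis
  proof cases
    case 1
    then show ?thesis using act_involution[OF N st(1)] by (simp add: cox_mat_def)
  next
    case 2
    then have "cox_mat N s t = 3" by (simp add: cox_mat_def)
    then show ?thesis
      using act_braid[OF 2(1) st(1,2) 2(3)] act_involution[OF N] st
      by (simp add: numeral_3_eq_3)
  next
    case 3
    then have "cox_mat N s t = 2" by (simp add: cox_mat_def)
    then show ?thesis
      using act_commute[OF 3(1) st(1,2) 3(3)] act_involution[OF N] st
      by (simp add: numeral_2_eq_2)
  qed
qed

text \<open>
  Elements act because the defining relations act trivially. For $N=1$ the only relations are the
  involutions, in accordance with the infinite dihedral group.
\<close>

lemma word_act_cong:
  assumes "N \<ge> 1" "cox_eq (gens N) (cox_mat N) u v"
  shows "word_act N u y = word_act N v y"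
  using assms(2)
proof (induction arbitrary: y rule: cox_eq.induct)
  case (rel u v s t)
  then show ?case using word_act_relation[OF assms(1)] by simp
qed simp_all

section \<open>Inversions and level of a window\<close>

text \<open>
  Windows of affine permutations have entries in distinct residue classes. Then no difference of
  entries is divisible by $N+1$, and negating such a difference $d$ sends $\lfloor d/(N+1)\rfloor$ to
  $-\lfloor d/(N+1)\rfloor-1$; this is what makes the inversion count change by exactly one.
\<close>

definition incongruent :: "nat \<Rightarrow> (nat \<Rightarrow> int) \<Rightarrow> bool" where
  "incongruent N y \<longleftrightarrow>
    (\<forall>p\<in>{1..N + 1}. \<forall>q\<in>{1..N + 1}. p \<noteq> q \<longrightarrow> \<not> int (N + 1) dvd y p - y q)"

definition index_pairs :: "nat \<Rightarrow> (nat \<times> nat) set" where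
  "index_pairs N = {(p, q). 1 \<le> p \<and> p < q \<and> q \<le> N + 1}"

text \<open>
  Shi's formula for the Coxeter length: the term at $(p,q)$ counts the hyperplanes parallel to
  $x_p=x_q$ that separate the alcove of $y$ from the base alcove, whose window is decreasing.
\<close>

definition inversions :: "nat \<Rightarrow> (nat \<Rightarrow> int) \<Rightarrow> int" where
  "inversions N y = (\<Sum>(p, q)\<in>index_pairs N. \<bar>(y p - y q) div int (N + 1)\<bar>)"

text \<open>
  Writing $y_p=(N+1)\lambda_p+c_p$ with $0\le c_p\le N$, the level is the sum of the positive
  $\lambda_p$. It depends only on the orbit of the coweight $\lambda$, and a letter $a_{N+1}$ moves
  $\lambda$ by one coroot, up to permutation.
\<close>

definition level :: "nat \<Rightarrow> (nat \<Rightarrow> int) \<Rightarrow> int" where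
  "level N y = (\<Sum>p\<in>{1..N + 1}. max 0 (y p div int (N + 1)))"

lemma incongruent_act:
  assumes y: "incongruent N y" and s: "s \<in> gens N" and N: "N \<ge> 1"
  shows "incongruent N (act N s y)"
proof (cases "s = Aff (N + 1)")
  case True
  define M where "M = int (N + 1)"
  define \<tau> where "\<tau> p = (if p = 1 then N + 1 else if p = N + 1 then 1 else p)" for p
  have shift: "\<exists>c. act N s y p = y (\<tau> p) + c * M" for p
    using exI[of "\<lambda>c. 0 = c * M" 0] exI[of "\<lambda>c. M = c * M" 1] exI[of "\<lambda>c. - M = c * M" "- 1"]
    by (auto simp: True act_def \<tau>_def M_def)
  have "\<not> M dvd act N s y p - act N s y q"
    if pq: "p \<in> {1..N + 1}" "q \<in> {1..N + 1}" "p \<noteq> q" for p q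
  proof -
    obtain c d where "act N s y p = y (\<tau> p) + c * M" "act N s y q = y (\<tau> q) + d * M"
      using shift by metis
    then have "act N s y p - act N s y q = (y (\<tau> p) - y (\<tau> q)) + (c - d) * M"
      by (simp add: algebra_simps)
    moreover have "\<tau> p \<in> {1..N + 1}" "\<tau> q \<in> {1..N + 1}" "\<tau> p \<noteq> \<tau> q"
      using pq by (auto simp: \<tau>_def)
    then have "\<not> M dvd y (\<tau> p) - y (\<tau> q)"
      using y unfolding incongruent_def M_def by blast
    ultimately show ?thesis by (simp add: dvd_add_left_iff)
  qed
  then show ?thesis by (simp add: incongruent_def M_def)
next
  case False
  then obtain k where "s = Sigma k" "1 \<le> k" "k \<le> N" using s by (auto simp: gens_def)
  then show ?thesis using y by (auto simp: incongruent_def act_def)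
qed

lemma finite_index_pairs: "finite (index_pairs N)"
  by (rule finite_subset[of _ "{..N + 1} \<times> {..N + 1}"]) (auto simp: index_pairs_def)

lemma neg_div_nondvd:
  fixes d M :: int
  assumes "\<not> M dvd d" "M > 0"
  shows "(- d) div M = - (d div M) - 1" and "(M - d) div M = - (d div M)"
proof -
  show 1: "(- d) div M = - (d div M) - 1"
    using assms by (auto simp: zdiv_zminus1_eq_if mod_eq_0_iff_dvd)
  have "(M - d) div M = (- d + 1 * M) div M" by simp
  also have "\<dots> = (- d) div M + 1" using assms(2) div_mult_self1[of M "- d" 1] by simp
  finally show "(M - d) div M = - (d div M)" using 1 by simp
qed

text \<open>
  Swapping the places $k$ and $k+1$ permutes all index pairs other than $(k,k+1)$ without changing
  their terms; only the term of that pair changes.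
\<close>

lemma inversions_act_Sigma:
  assumes y: "incongruent N y" and k: "1 \<le> k" "k \<le> N"
  shows "inversions N (act N (Sigma k) y) = inversions N y + (if y k > y (k + 1) then 1 else - 1)"
proof -
  define M where "M = int (N + 1)"
  let ?P = "index_pairs N" and ?e = "(k, k + 1)" and ?y = "act N (Sigma k) y"
  define \<tau> where "\<tau> p = (if p = k then k + 1 else if p = k + 1 then k else p)" for p
  have e: "?e \<in> ?P" using k by (simp add: index_pairs_def)
  have rest: "(\<Sum>(p, q)\<in>?P - {?e}. \<bar>(?y p - ?y q) div M\<bar>) = (\<Sum>(p, q)\<in>?P - {?e}. \<bar>(y p - y q) div M\<bar>)"
    by (rule sum.reindex_bij_witness[where i = "map_prod \<tau> \<tau>" and j = "map_prod \<tau> \<tau>"])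
      (use k in \<open>auto simp: index_pairs_def \<tau>_def act_def split: if_splits\<close>)
  have nd: "\<not> M dvd y k - y (k + 1)" using y k by (auto simp: incongruent_def M_def)
  have M: "M > 0" by (simp add: M_def)
  have "(y (k + 1) - y k) div M = - ((y k - y (k + 1)) div M) - 1"
    using neg_div_nondvd(1)[OF nd M] by simp
  moreover have "(y k - y (k + 1)) div M \<ge> 0 \<longleftrightarrow> y k > y (k + 1)"
  proof -
    have "y k \<noteq> y (k + 1)" using nd by auto
    then show ?thesis using M by (auto simp: pos_imp_zdiv_nonneg_iff)
  qed
  ultimately have pair: "\<bar>(?y k - ?y (k + 1)) div M\<bar>
      = \<bar>(y k - y (k + 1)) div M\<bar> + (if y k > y (k + 1) then 1 else - 1)"
    by (auto simp: act_def)
  have "inversions N z = \<bar>(z k - z (k + 1)) div M\<bar> + (\<Sum>(p, q)\<in>?P - {?e}. \<bar>(z p - z q) div M\<bar>)" for z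
    unfolding inversions_def M_def[symmetric] by (subst sum.remove[OF finite_index_pairs e]) simp
  from this[of ?y] this[of y] rest pair show ?thesis by (simp add: M_def)
qed

text \<open>
  Here the pairs $(1,q)$ and $(q,N+1)$ trade their terms: a difference $d$ becomes $(N+1)-d$, and
  $\lfloor ((N+1)-d)/(N+1)\rfloor=-\lfloor d/(N+1)\rfloor$ as $N+1$ does not divide $d$. Only the
  pair of the two ends contributes a change.
\<close>

lemma inversions_act_Aff:
  assumes y: "incongruent N y" and N: "N \<ge> 1"
  shows "inversions N (act N (Aff (N + 1)) y)
    = inversions N y + (if y 1 < y (N + 1) + int (N + 1) then 1 else - 1)"
proof -
  define M where "M = int (N + 1)"
  let ?P = "index_pairs N" and ?e = "(1, N + 1)" and ?y = "act N (Aff (N + 1)) y"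
  define \<phi> :: "nat \<times> nat \<Rightarrow> nat \<times> nat" where
    "\<phi> = (\<lambda>(p, q). if p = 1 then (q, N + 1) else if q = N + 1 then (1, p) else (p, q))"
  have e: "?e \<in> ?P" using N by (simp add: index_pairs_def)
  have M: "M > 0" by (simp add: M_def)
  have ya: "?y 1 = y (N + 1) + M" "?y (N + 1) = y 1 - M" "p \<noteq> 1 \<Longrightarrow> p \<noteq> N + 1 \<Longrightarrow> ?y p = y p" for p
    using N by (auto simp: act_def M_def)
  have nd: "\<not> M dvd y p - y q" if "(p, q) \<in> ?P" for p q
    using y that by (auto simp: incongruent_def M_def index_pairs_def)
  have flip: "(M - (y p - y q)) div M = - ((y p - y q) div M)" if "(p, q) \<in> ?P" for p q
    using neg_div_nondvd(2)[OF nd[OF that] M] .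
  have rest: "(\<Sum>(p, q)\<in>?P - {?e}. \<bar>(y p - y q) div M\<bar>) = (\<Sum>(p, q)\<in>?P - {?e}. \<bar>(?y p - ?y q) div M\<bar>)"
  proof (rule sum.reindex_bij_witness[where i = \<phi> and j = \<phi>])
    fix e assume e: "e \<in> ?P - {?e}"
    then show "\<phi> (\<phi> e) = e" "\<phi> (\<phi> e) = e" "\<phi> e \<in> ?P - {?e}" "\<phi> e \<in> ?P - {?e}"
      by (auto simp: \<phi>_def index_pairs_def split: if_splits)
    obtain p q where pq: "e = (p, q)" by force
    have P: "(p, q) \<in> ?P" "(p, q) \<noteq> ?e" using e pq by auto
    consider "p = 1" "q \<noteq> 1" "q \<noteq> N + 1" | "q = N + 1" "p \<noteq> 1" "p \<noteq> N + 1"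
      | "p \<noteq> 1" "q \<noteq> 1" "p \<noteq> N + 1" "q \<noteq> N + 1"
      using P by (auto simp: index_pairs_def)
    then have "\<bar>(?y (fst (\<phi> e)) - ?y (snd (\<phi> e))) div M\<bar> = \<bar>(y p - y q) div M\<bar>"
    proof cases
      case 1
      then have "?y (fst (\<phi> e)) - ?y (snd (\<phi> e)) = M - (y p - y q)"
        using ya by (simp add: pq \<phi>_def)
      then show ?thesis using flip[OF P(1)] by simp
    next
      case 2
      then have "?y (fst (\<phi> e)) - ?y (snd (\<phi> e)) = M - (y p - y q)"
        using ya by (simp add: pq \<phi>_def)
      then show ?thesis using flip[OF P(1)] by simp
    next
      case 3
      then show ?thesis using ya by (simp add: pq \<phi>_def)
    qed
    then show "(case \<phi> e of (p, q) \<Rightarrow> \<bar>(?y p - ?y q) div M\<bar>) = (case e of (p, q) \<Rightarrow> \<bar>(y p - y q) div M\<bar>)"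
      by (simp add: pq case_prod_unfold)
  qed
  have "?y 1 - ?y (N + 1) = M - (y 1 - y (N + 1)) + 1 * M" using ya by simp
  then have "(?y 1 - ?y (N + 1)) div M = (M - (y 1 - y (N + 1))) div M + 1"
    using M div_mult_self1[of M "M - (y 1 - y (N + 1))" 1] by simp
  then have "(?y 1 - ?y (N + 1)) div M = 1 - (y 1 - y (N + 1)) div M"
    using flip[OF e] by simp
  moreover have "(y 1 - y (N + 1)) div M \<le> 0 \<longleftrightarrow> y 1 < y (N + 1) + M"
  proof -
    have "(y 1 - y (N + 1)) div M \<ge> 1 \<longleftrightarrow> 1 * M \<le> y 1 - y (N + 1)"
      using M by (metis zdiv_mono1 nonzero_mult_div_cancel_right less_irrefl pos_imp_zdiv_pos_iff
          mult_1 zero_less_one int_one_le_iff_zero_less)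
    then show ?thesis by auto
  qed
  ultimately have pair: "\<bar>(?y 1 - ?y (N + 1)) div M\<bar>
      = \<bar>(y 1 - y (N + 1)) div M\<bar> + (if y 1 < y (N + 1) + M then 1 else - 1)"
    by auto
  have "inversions N z = \<bar>(z 1 - z (N + 1)) div M\<bar> + (\<Sum>(p, q)\<in>?P - {?e}. \<bar>(z p - z q) div M\<bar>)" for z
    unfolding inversions_def M_def[symmetric] by (subst sum.remove[OF finite_index_pairs e]) simp
  from this[of ?y] this[of y] rest pair show ?thesis by (simp add: M_def)
qed

lemma level_act_Sigma:
  assumes k: "1 \<le> k" "k \<le> N"
  shows "level N (act N (Sigma k) y) = level N y"
proof -
  define \<tau> where "\<tau> p = (if p = k then k + 1 else if p = k + 1 then k else p)" for p
  show ?thesis unfolding level_def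
    by (rule sum.reindex_bij_witness[where i = \<tau> and j = \<tau>])
      (use k in \<open>auto simp: \<tau>_def act_def split: if_splits\<close>)
qed

text \<open>
  The quotients of the end entries become $\lfloor y_{N+1}/(N+1)\rfloor+1$ and
  $\lfloor y_1/(N+1)\rfloor-1$. The positive part of the former grows by one exactly if
  $y_{N+1}\ge 0$, and that of the latter does not drop exactly if $y_1<N+1$.
\<close>

lemma level_act_Aff:
  assumes N: "N \<ge> 1"
  shows "level N (act N (Aff (N + 1)) y) \<le> level N y + 1"
    and "y 1 < int (N + 1) \<Longrightarrow> 0 \<le> y (N + 1) \<Longrightarrow> level N (act N (Aff (N + 1)) y) = level N y + 1"
proof -
  define M where "M = int (N + 1)"
  have M: "M > 0" by (simp add: M_def)
  have split: "level N z = max 0 (z 1 div M) + max 0 (z (N + 1) div M) + (\<Sum>p\<in>{2..N}. max 0 (z p div M))"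
    for z
  proof -
    have "{1..N + 1} = insert 1 (insert (N + 1) {2..N})" using N by auto
    then show ?thesis using N unfolding level_def M_def by simp
  qed
  let ?y = "act N (Aff (N + 1)) y"
  have mid: "(\<Sum>p\<in>{2..N}. max 0 (?y p div M)) = (\<Sum>p\<in>{2..N}. max 0 (y p div M))"
    by (rule sum.cong) (auto simp: act_def)
  have ends: "?y 1 div M = y (N + 1) div M + 1" "?y (N + 1) div M = y 1 div M - 1"
  proof -
    have "?y 1 = y (N + 1) + M" "?y (N + 1) = y 1 - M" using N by (auto simp: act_def M_def)
    then show "?y 1 div M = y (N + 1) div M + 1" "?y (N + 1) div M = y 1 div M - 1"
      using M div_mult_self1[of M "y (N + 1)" 1] div_mult_self1[of M "y 1" "- 1"] by simp_all
  qed
  show "level N ?y \<le> level N y + 1" unfolding split mid ends by auto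
  assume "y 1 < int (N + 1)" "0 \<le> y (N + 1)"
  then have "y 1 div M \<le> 0" "0 \<le> y (N + 1) div M"
    using M zdiv_mono1[of "y 1" "M - 1" M]
    by (auto simp: M_def pos_imp_zdiv_nonneg_iff)
  then show "level N ?y = level N y + 1" unfolding split mid ends by auto
qed

text \<open>
  For $a_{N+1}$ the condition is chosen so that both statistics grow; the inversions alone would only
  require \<open>y 1 < y (N + 1) + (N + 1)\<close>.
\<close>

definition ascent :: "nat \<Rightarrow> gen \<Rightarrow> (nat \<Rightarrow> int) \<Rightarrow> bool" where
  "ascent N g y = (case g of
      Sigma k \<Rightarrow> y (k + 1) < y k
    | Aff _ \<Rightarrow> y 1 < int (N + 1) \<and> 0 \<le> y (N + 1))"

fun ascending :: "nat \<Rightarrow> gen list \<Rightarrow> (nat \<Rightarrow> int) \<Rightarrow> bool" where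
  "ascending N [] y = True"
| "ascending N (g # u) y = (ascending N u y \<and> ascent N g (word_act N u y))"

lemma ascending_append:
  "ascending N (u @ v) y \<longleftrightarrow> ascending N v y \<and> ascending N u (word_act N v y)"
  by (induction u) auto

lemma incongruent_word_act:
  "N \<ge> 1 \<Longrightarrow> u \<in> lists (gens N) \<Longrightarrow> incongruent N y \<Longrightarrow> incongruent N (word_act N u y)"
  by (induction u) (auto simp: incongruent_act)

lemma statistics_act:
  assumes N: "N \<ge> 1" and s: "s \<in> gens N" and y: "incongruent N y"
  shows "inversions N (act N s y) \<le> inversions N y + 1"
    and "level N (act N s y) \<le> level N y + (if s = Aff (N + 1) then 1 else 0)"
    and "ascent N s y \<Longrightarrow> inversions N (act N s y) = inversions N y + 1"
    and "ascent N s y \<Longrightarrow> level N (act N s y) = level N y + (if s = Aff (N + 1) then 1 else 0)"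
  using s inversions_act_Sigma[OF y] inversions_act_Aff[OF y N] level_act_Sigma[of _ N y]
    level_act_Aff[OF N, of y]
  by (auto simp: gens_def ascent_def)

lemma statistics_word_act:
  assumes N: "N \<ge> 1" and u: "u \<in> lists (gens N)" and y: "incongruent N y"
  shows "inversions N (word_act N u y) \<le> inversions N y + int (length u)"
    and "level N (word_act N u y) \<le> level N y + int (count_list u (Aff (N + 1)))"
    and "ascending N u y \<Longrightarrow> inversions N (word_act N u y) = inversions N y + int (length u)"
    and "ascending N u y \<Longrightarrow> level N (word_act N u y) = level N y + int (count_list u (Aff (N + 1)))"
proof -
  have "inversions N (word_act N u y) \<le> inversions N y + int (length u)
    \<and> level N (word_act N u y) \<le> level N y + int (count_list u (Aff (N + 1)))
    \<and> (ascending N u y \<longrightarrow> inversions N (word_act N u y) = inversions N y + int (length u)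
        \<and> level N (word_act N u y) = level N y + int (count_list u (Aff (N + 1))))"
    using u
  proof (induction u)
    case (Cons s u)
    then show ?case
      using statistics_act[OF N _ incongruent_word_act[OF N _ y], of s u] by auto
  qed simp
  then show "inversions N (word_act N u y) \<le> inversions N y + int (length u)"
    "level N (word_act N u y) \<le> level N y + int (count_list u (Aff (N + 1)))"
    "ascending N u y \<Longrightarrow> inversions N (word_act N u y) = inversions N y + int (length u)"
    "ascending N u y \<Longrightarrow> level N (word_act N u y) = level N y + int (count_list u (Aff (N + 1)))"
    by blast+
qed

text \<open>
  The window standing for the identity. Its entries are $N,\dots,0$, so that the levels of the entries are all
  zero and \<open>Sigma k\<close> is an ascent when the entry at the smaller place is the larger one.
\<close>

definition base_window :: "nat \<Rightarrow> nat \<Rightarrow> int" where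
  "base_window N p = int (N + 1) - int p"

lemma incongruent_base_window: "incongruent N (base_window N)"
proof -
  have "\<not> int (N + 1) dvd base_window N p - base_window N q" if "p \<in> {1..N + 1}" "q \<in> {1..N + 1}" "p \<noteq> q" for p q
  proof
    assume "int (N + 1) dvd base_window N p - base_window N q"
    moreover have "\<bar>base_window N p - base_window N q\<bar> < int (N + 1)" "base_window N p - base_window N q \<noteq> 0"
      using that by (auto simp: base_window_def)
    ultimately show False
      using dvd_imp_le_int[of "base_window N p - base_window N q" "int (N + 1)"] by linarith
  qed
  then show ?thesis by (auto simp: incongruent_def)
qed

text \<open>
  The final window depends only on the element. An ascending word attains both of its statistics
  with equality, while any other expression must reach the same values.
\<close>

lemma ascending_imp_minimal:
  assumes N: "N \<ge> 1" and u: "u \<in> lists (gens N)" "ascending N u (base_window N)"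
    and v: "v \<in> lists (gens N)" "elt N v = elt N u"
  shows "length u \<le> length v"
    and "count_list u (Aff (N + 1)) \<le> count_list v (Aff (N + 1))"
proof -
  have "word_act N v (base_window N) = word_act N u (base_window N)"
    using word_act_cong[OF N, of v u] elt_eq_iff[OF v(1), of u] v(2) by simp
  then show "length u \<le> length v" "count_list u (Aff (N + 1)) \<le> count_list v (Aff (N + 1))"
    using statistics_word_act[OF N u(1) incongruent_base_window]
      statistics_word_act[OF N v(1) incongruent_base_window] u(2) by auto
qed

lemma ascending_reduced:
  assumes N: "N \<ge> 1" and u: "u \<in> lists (gens N)" "ascending N u (base_window N)"
  shows "reduced_expr N u (elt N u)"
    and "affine_length N (elt N u) = count_list u (Aff (N + 1))"
proof -
  have "len N (elt N u) = length u"
    unfolding len_def cox_length_def elt_def[symmetric]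
    by (rule Least_equality) (use u ascending_imp_minimal(1)[OF N u] in auto)
  then show red: "reduced_expr N u (elt N u)" using u(1) by (simp add: reduced_expr_def expression_def)
  show "affine_length N (elt N u) = count_list u (Aff (N + 1))"
    unfolding affine_length_def
    by (rule Least_equality)
      (use red ascending_imp_minimal(2)[OF N u] in \<open>auto simp: reduced_expr_def expression_def\<close>)
qed

section \<open>Words in the generators and the pairwise inequalities\<close>

lemma set_up: "set (up p l) = Sigma ` {p..l}"
  by (auto simp: up_def)

lemma set_down: "set (down i) = Sigma ` {1..i}"
  by (auto simp: down_def)

lemma up_Cons: "p \<le> l \<Longrightarrow> up p l = Sigma p # up (p + 1) l"
  by (simp add: up_def upt_conv_Cons)

lemma up_empty: "l < p \<Longrightarrow> up p l = []"
  by (simp add: up_def)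

lemma down_Suc: "down (Suc i) = Sigma (Suc i) # down i"
  by (simp add: down_def)

lemma up_lists: "1 \<le> p \<Longrightarrow> l \<le> n \<Longrightarrow> up p l \<in> lists (gens n)"
  by (auto simp: set_up gens_def)

lemma down_lists: "i \<le> n \<Longrightarrow> down i \<in> lists (gens n)"
  by (auto simp: set_down gens_def)

lemma length_up: "length (up p l) = l + 1 - p"
  by (cases "p \<le> l") (simp_all add: up_def Suc_diff_le)

lemma length_down: "length (down i) = i"
  by (simp add: down_def)

lemma up_append: "p \<le> q + 1 \<Longrightarrow> q \<le> l \<Longrightarrow> up p q @ up (q + 1) l = up p l"
  unfolding up_def using upt_add_eq_append[of p "q + 1" "l - q"] by (simp flip: map_append)

lemma down_split:
  assumes "k \<le> i"
  shows "down i = map Sigma (rev [k + 1..<i + 1]) @ down k"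
proof -
  have "[1..<i + 1] = [1..<k + 1] @ [k + 1..<i + 1]"
    using upt_add_eq_append[of 1 "k + 1" "i - k"] assms by simp
  then show ?thesis by (simp add: down_def)
qed

text \<open>
  The exceptional value $i_s=0$, $j_s=1$ of the second condition satisfies these bounds as well.
\<close>

lemma pairwise_bounds:
  assumes pw: "pairwise_ineqs N m j i" and N: "N \<ge> 1" and s: "1 \<le> s" "s \<le> m"
  shows "1 \<le> j s" "j s \<le> N + 1" "i s + 1 \<le> N"
proof -
  have "1 \<le> j s \<and> j s \<le> N + 1 \<and> i s + 1 \<le> N"
  proof (cases "s = 1")
    case True
    then show ?thesis using pw by (simp add: pairwise_ineqs_def)
  next
    case False
    then have "s \<in> {2..m}" using s by simp
    then have "(i s = 0 \<and> j s = 1) \<or> (1 \<le> i s \<and> i s + 1 \<le> N \<and> 1 \<le> j s \<and> j s \<le> N)"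
      using pw unfolding pairwise_ineqs_def by blast
    then show ?thesis using N by auto
  qed
  then show "1 \<le> j s" "j s \<le> N + 1" "i s + 1 \<le> N" by simp_all
qed

lemma pairwise_step:
  assumes pw: "pairwise_ineqs N m j i" and s: "1 \<le> s" "Suc s \<le> m"
  shows "j (Suc s) \<le> j s" "i s \<le> i (Suc s)"
    and "i s + 1 < j s \<Longrightarrow> j (Suc s) < j s"
    and "i (Suc s) + 1 < j (Suc s) \<Longrightarrow> i s < i (Suc s)"
proof -
  have "\<forall>s\<in>{2..m}. j s \<le> j (s - 1) \<and> i s \<ge> i (s - 1)"
    "\<forall>s\<in>{2..m}. j (s - 1) > i (s - 1) + 1 \<longrightarrow> j s < j (s - 1)"
    "\<forall>s\<in>{2..m}. j s > i s + 1 \<longrightarrow> i s > i (s - 1)"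
    using pw unfolding pairwise_ineqs_def by blast+
  from this[THEN bspec, of "Suc s"]
  show "j (Suc s) \<le> j s" "i s \<le> i (Suc s)" "i s + 1 < j s \<Longrightarrow> j (Suc s) < j s"
    "i (Suc s) + 1 < j (Suc s) \<Longrightarrow> i s < i (Suc s)" using s by simp_all
qed

lemma pairwise_mono:
  assumes "pairwise_ineqs N m j i" "1 \<le> k" "k \<le> l" "l \<le> m"
  shows "i k \<le> i l"
  using assms(3,4)
proof (induction l rule: dec_induct)
  case (step l)
  then show ?case using pairwise_step(2)[OF assms(1), of l] assms(2) by simp
qed simp

lemma canonical_A_lists:
  assumes "canonical_A N x"
  shows "x \<in> lists (Sigma ` {1..N})"
proof -
  obtain t k l where kl: "\<forall>p\<in>{1..t}. 1 \<le> k p \<and> k p \<le> l p \<and> l p \<le> N"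
    and x: "x = concat (map (\<lambda>p. up (k p) (l p)) [1..<t + 1])"
    using assms unfolding canonical_A_def by blast
  have "set (up (k p) (l p)) \<subseteq> Sigma ` {1..N}" if "p \<in> set [1..<t + 1]" for p
  proof -
    have "p \<in> {1..t}" using that by auto
    then have "1 \<le> k p" "l p \<le> N" using kl by auto
    then show ?thesis by (auto simp: set_up)
  qed
  then have "set x \<subseteq> Sigma ` {1..N}" unfolding x set_concat set_map by blast
  then show ?thesis by (simp add: lists_eq_set)
qed

section \<open>Canonical words are ascending\<close>

text \<open>
  $\lfloor r,l\rfloor$ carries the entry at place $l+1$ to the left into place $r$; dually,
  $\lceil i,1\rceil$ carries the first entry to the right into place $i+1$. Such a drag consists of
  ascents if the dragged entry is smaller, respectively larger, than every entry it passes.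
\<close>

lemma word_act_up:
  assumes "r \<le> l + 1"
  shows "word_act N (up r l) y p
    = (if r \<le> p \<and> p \<le> l + 1 then if p = r then y (l + 1) else y (p - 1) else y p)"
  using assms
proof (induction r arbitrary: p rule: inc_induct)
  case base
  then show ?case by (cases "p = l + 1") (auto simp: up_empty)
next
  case (step r)
  then show ?case by (auto simp: up_Cons[of r l] act_def)
qed

lemma ascending_up:
  assumes "r \<le> l + 1" "\<forall>p. r \<le> p \<and> p \<le> l \<longrightarrow> y (l + 1) < y p"
  shows "ascending N (up r l) y"
  using assms
proof (induction r rule: inc_induct)
  case base
  then show ?case by (simp add: up_empty)
next
  case (step r)
  then show ?case by (auto simp: up_Cons[of r l] ascent_def word_act_up)
qed

lemma word_act_down:
  assumes "p \<ge> 1"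
  shows "word_act N (down i) y p = (if p \<le> i then y (p + 1) else if p = i + 1 then y 1 else y p)"
  using assms
proof (induction i arbitrary: p)
  case 0
  then show ?case by (simp add: down_def)
next
  case (Suc i)
  then show ?case by (auto simp: down_Suc act_def)
qed

lemma ascending_down:
  assumes "\<forall>p. 2 \<le> p \<and> p \<le> i + 1 \<longrightarrow> y p < y 1"
  shows "ascending N (down i) y"
  using assms
proof (induction i)
  case 0
  then show ?case by (simp add: down_def)
next
  case (Suc i)
  then show ?case by (auto simp: down_Suc ascent_def word_act_down)
qed

text \<open>
  One block $h_N(r,i)a_{N+1}$. The affine letter produces a first entry $A\ge N+1$ and a last entry
  $B<0$. Then $A$ moves right past $i$ entries and $B$ moves left to place $r$, which pushes $A$ one
  place further right if $r\le i+1$. The assumptions say that the entries $A$ passes are less than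
  $N+1$ and those $B$ passes are nonnegative; they include the old first and last entries, which turn
  into $B$ and $A$. Since \<open>r\<close> refers to the window after $A$ has moved, the
  entries passed by $B$ start at old place $r+1$ if $r\le i+1$ and at old place $r$ otherwise. The
  conclusions say the same about the entries left of $A$ and right of $B$ in the new window.
\<close>

lemma block_ascending:
  assumes N: "N \<ge> 1" and r: "1 \<le> r" "r \<le> N + 1" and i: "i + 1 \<le> N"
    and small: "\<forall>p. 1 \<le> p \<and> p \<le> i + 1 \<longrightarrow> z p < int (N + 1)"
    and nonneg: "\<forall>p. (if r \<le> i + 1 then r + 1 else r) \<le> p \<and> p \<le> N + 1 \<longrightarrow> 0 \<le> z p"
  defines "z' \<equiv> word_act N (h_word N r i @ [Aff (N + 1)]) z"
  shows "ascending N (h_word N r i @ [Aff (N + 1)]) z"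
    and "\<forall>p. 1 \<le> p \<and> p < (if r \<le> i + 1 then i + 2 else i + 1) \<longrightarrow> z' p < int (N + 1)"
    and "\<forall>p. r < p \<and> p \<le> N + 1 \<longrightarrow> 0 \<le> z' p"
proof -
  define z1 where "z1 = act N (Aff (N + 1)) z"
  define z2 where "z2 = word_act N (down i) z1"
  have z1: "z1 1 = z (N + 1) + int (N + 1)" "z1 (N + 1) = z 1 - int (N + 1)"
    "p \<noteq> 1 \<Longrightarrow> p \<noteq> N + 1 \<Longrightarrow> z1 p = z p" for p
    using N by (auto simp: z1_def act_def)
  have ends: "z 1 < int (N + 1)" "0 \<le> z (N + 1)"
    using small nonneg r i by auto
  have z2: "z2 p = (if p \<le> i then z (p + 1) else if p = i + 1 then z (N + 1) + int (N + 1) else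
      if p = N + 1 then z 1 - int (N + 1) else z p)" if "1 \<le> p" for p
    unfolding z2_def word_act_down[OF that] using z1 i that by auto
  have z2_nonneg: "0 \<le> z2 p" if "r \<le> p" "p \<le> N" for p
    using z2[of p] nonneg ends i r that by (auto split: if_splits)
  have z2_last: "z2 (N + 1) < 0" using z2[of "N + 1"] i ends by auto
  have z': "z' p = (if r \<le> p \<and> p \<le> N + 1 then if p = r then z2 (N + 1) else z2 (p - 1) else z2 p)" for p
  proof -
    have "z' = word_act N (up r N) z2" by (simp add: z'_def h_word_def z1_def z2_def)
    then show ?thesis using word_act_up[of r N N z2 p] r by simp
  qed
  have "ascending N (up r N) z2"
  proof (rule ascending_up)
    show "\<forall>p. r \<le> p \<and> p \<le> N \<longrightarrow> z2 (N + 1) < z2 p"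
      using z2_nonneg z2_last by (meson less_le_trans)
  qed (use r in simp)
  moreover have "ascending N (down i) z1"
  proof (rule ascending_down, intro allI impI)
    fix p assume p: "2 \<le> p \<and> p \<le> i + 1"
    then have "z1 p < int (N + 1)" using z1(3)[of p] small i by simp
    then show "z1 p < z1 1" using z1(1) ends by simp
  qed
  moreover have "ascent N (Aff (N + 1)) z" using ends by (simp add: ascent_def)
  ultimately show "ascending N (h_word N r i @ [Aff (N + 1)]) z"
    by (simp add: h_word_def ascending_append z1_def z2_def)
  show "\<forall>p. r < p \<and> p \<le> N + 1 \<longrightarrow> 0 \<le> z' p"
    using z' z2_nonneg by auto
  show "\<forall>p. 1 \<le> p \<and> p < (if r \<le> i + 1 then i + 2 else i + 1) \<longrightarrow> z' p < int (N + 1)"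
  proof (intro allI impI)
    fix p assume p: "1 \<le> p \<and> p < (if r \<le> i + 1 then i + 2 else i + 1)"
    consider "p < r" "p \<le> i" | "p = r" | "r < p" "p - 1 \<le> i" "1 \<le> p - 1"
      using p r by (cases p r rule: linorder_cases) (auto split: if_splits)
    then show "z' p < int (N + 1)"
    proof cases
      case 1
      then have "z' p = z (p + 1)" using z' z2[of p] p by simp
      then show ?thesis using small 1 by simp
    next
      case 2
      then have "z' p = z2 (N + 1)" using z' r by simp
      then show ?thesis using z2_last by simp
    next
      case 3
      moreover have "p \<le> N + 1" using p i by (auto split: if_splits)
      ultimately have "z' p = z2 (p - 1)" using z' by simp
      also have "\<dots> = z p" using z2[of "p - 1"] 3 by simp
      finally show ?thesis using small 3 by simp
    qed
  qed
qed

text \<open>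
  Factors act from the last one, with the smallest $l_q$, to the first. When $\lfloor k_q,l_q\rfloor$
  is applied, the entry at place $l_q+1$ has not been moved yet; as the initial window is
  decreasing, it is smaller than all the entries before it, some of which it has to pass.
\<close>

lemma ascending_canonical_A:
  assumes "canonical_A N x"
  shows "ascending N x (base_window N)"
    and "\<forall>p. 1 \<le> p \<and> p \<le> N + 1 \<longrightarrow> 0 \<le> word_act N x (base_window N) p \<and> word_act N x (base_window N) p < int (N + 1)"
proof -
  obtain t k l where kl: "\<forall>p\<in>{1..t}. 1 \<le> k p \<and> k p \<le> l p \<and> l p \<le> N"
    and dec: "\<forall>p\<in>{1..<t}. l p > l (p + 1)"
    and x: "x = concat (map (\<lambda>p. up (k p) (l p)) [1..<t + 1])"
    using assms unfolding canonical_A_def by blast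
  define v where "v q = concat (map (\<lambda>p. up (k p) (l p)) [q..<t + 1])" for q
  define z where "z q = word_act N (v q) (base_window N)" for q
  \<comment> \<open>Places beyond \<open>top q + 1\<close> are untouched by the factors from \<open>q\<close> on; the value 0 stands for no factor.\<close>
  define top where "top q = (if q \<le> t then l q else 0)" for q
  have "ascending N (v q) (base_window N) \<and> (\<forall>p > top q + 1. z q p = base_window N p)
      \<and> (\<forall>p. 1 \<le> p \<and> p \<le> top q + 1 \<longrightarrow> base_window N (top q + 1) \<le> z q p \<and> z q p < int (N + 1))"
    if "1 \<le> q" "q \<le> t + 1" for q
    using that(2,1)
  proof (induction q rule: inc_induct)
    case base
    then show ?case by (simp add: v_def z_def top_def base_window_def)
  next
    case (step q)
    have vq: "v q = up (k q) (l q) @ v (Suc q)"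
      using step by (simp add: v_def upt_conv_Cons del: upt_Suc)
    have IH: "ascending N (v (Suc q)) (base_window N)" "\<forall>p > top (Suc q) + 1. z (Suc q) p = base_window N p"
      "\<forall>p. 1 \<le> p \<and> p \<le> top (Suc q) + 1 \<longrightarrow>
        base_window N (top (Suc q) + 1) \<le> z (Suc q) p \<and> z (Suc q) p < int (N + 1)"
      using step by auto
    have q: "1 \<le> k q" "k q \<le> l q" "l q \<le> N" using kl step by auto
    have lt: "top (Suc q) < l q" using dec q step by (auto simp: top_def)
    have bound: "base_window N (l q) \<le> z (Suc q) p \<and> z (Suc q) p < int (N + 1)" if "1 \<le> p" "p \<le> l q" for p
    proof (cases "p \<le> top (Suc q) + 1")
      case True
      then have "base_window N (top (Suc q) + 1) \<le> z (Suc q) p \<and> z (Suc q) p < int (N + 1)"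
        using IH(3) that by blast
      moreover have "base_window N (l q) \<le> base_window N (top (Suc q) + 1)" using lt by (simp add: base_window_def)
      ultimately show ?thesis by linarith
    next
      case False
      then show ?thesis using IH(2) that by (simp add: base_window_def)
    qed
    have last: "z (Suc q) (l q + 1) = base_window N (l q + 1)" using IH(2) lt by simp
    have zq: "z q p = (if k q \<le> p \<and> p \<le> l q + 1 then if p = k q then z (Suc q) (l q + 1)
        else z (Suc q) (p - 1) else z (Suc q) p)" for p
      unfolding z_def vq using q by (simp add: word_act_up)
    have "ascending N (up (k q) (l q)) (z (Suc q))"
    proof (rule ascending_up, use q in simp, intro allI impI)
      fix p assume p: "k q \<le> p \<and> p \<le> l q"
      then have "base_window N (l q) \<le> z (Suc q) p" using bound[of p] q by auto
      then show "z (Suc q) (l q + 1) < z (Suc q) p" using last by (simp add: base_window_def)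
    qed
    then have "ascending N (v q) (base_window N)"
      using IH(1) by (simp add: vq ascending_append z_def)
    moreover have "\<forall>p > top q + 1. z q p = base_window N p"
      using zq IH(2) lt step by (auto simp: top_def)
    moreover have "base_window N (top q + 1) \<le> z q p \<and> z q p < int (N + 1)" if p: "1 \<le> p" "p \<le> top q + 1" for p
    proof -
      have t: "top q = l q" using step by (simp add: top_def)
      have le: "base_window N (l q + 1) \<le> base_window N (l q)" by (simp add: base_window_def)
      consider "p = k q" | "k q < p" "p \<le> l q + 1" | "p < k q" "p \<le> l q" using p q t by force
      then show ?thesis
      proof cases
        case 1
        then show ?thesis using zq[of p] last t q by (simp add: base_window_def)
      next
        case 2
        then have "1 \<le> p - 1" "p - 1 \<le> l q" using q by auto
        then show ?thesis using zq[of p] bound[of "p - 1"] t le 2 by auto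
      next
        case 3
        then show ?thesis using zq[of p] bound[of p] t le p by auto
      qed
    qed
    ultimately show ?case by blast
  qed
  from this[of 1] have 1: "ascending N (v 1) (base_window N)" "\<forall>p > top 1 + 1. z 1 p = base_window N p"
      "\<forall>p. 1 \<le> p \<and> p \<le> top 1 + 1 \<longrightarrow> base_window N (top 1 + 1) \<le> z 1 p \<and> z 1 p < int (N + 1)"
    by auto
  have xv: "x = v 1" by (simp add: x v_def)
  show "ascending N x (base_window N)" using 1(1) xv by simp
  have top: "top 1 \<le> N" using kl by (auto simp: top_def)
  have "0 \<le> z 1 p \<and> z 1 p < int (N + 1)" if p: "1 \<le> p" "p \<le> N + 1" for p
  proof (cases "p \<le> top 1 + 1")
    case True
    then have "base_window N (top 1 + 1) \<le> z 1 p \<and> z 1 p < int (N + 1)" using 1(3) p by blast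
    moreover have "0 \<le> base_window N (top 1 + 1)" using top by (simp add: base_window_def)
    ultimately show ?thesis by linarith
  next
    case False
    then have "z 1 p = base_window N p" using 1(2) by simp
    then show ?thesis using p by (simp add: base_window_def)
  qed
  then show "\<forall>p. 1 \<le> p \<and> p \<le> N + 1 \<longrightarrow> 0 \<le> word_act N x (base_window N) p \<and> word_act N x (base_window N) p < int (N + 1)"
    by (simp add: z_def xv)
qed

text \<open>
  Blocks act from the last one to the first, so passing to the next block means decreasing \<open>s\<close>. By
  the pairwise inequalities, everything that the large and the negative entry of block $s$ have to
  pass lies left of the large entry, respectively right of the negative entry, of block $s+1$: this
  is what the conditions on $j_s$ and $i_s$, including the strict ones, are for.
\<close>

lemma ascending_canonical_word:
  assumes N: "N \<ge> 1" and form: "canonical_form N m j i x"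
  shows "ascending N (canonical_word N m j i x) (base_window N)"
proof -
  have pw: "pairwise_ineqs N m j i" and x: "canonical_A N x"
    using form by (auto simp: canonical_form_def)
  note bounds = pairwise_bounds[OF pw N]
  \<comment> \<open>The negative entry of block \<open>s\<close> passes places from \<open>c s\<close> on; its large entry ends at place \<open>d s\<close>.\<close>
  define c where "c s = (if j s \<le> i s + 1 then j s + 1 else j s)" for s
  define d where "d s = (if j s \<le> i s + 1 then i s + 2 else i s + 1)" for s
  have nest: "i s + 1 < d (Suc s)" "j (Suc s) < c s" if "1 \<le> s" "Suc s \<le> m" for s
  proof -
    show "i s + 1 < d (Suc s)" "j (Suc s) < c s" using pairwise_step[OF pw that] by (auto simp: c_def d_def)
  qed
  define v where "v s = concat (map (\<lambda>s. h_word N (j s) (i s) @ [Aff (N + 1)]) [s..<m + 1]) @ x" for s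
  define z where "z s = word_act N (v s) (base_window N)" for s
  have "ascending N (v s) (base_window N)
      \<and> (\<forall>p. 1 \<le> p \<and> p \<le> N + 1 \<and> (s \<le> m \<longrightarrow> p < d s) \<longrightarrow> z s p < int (N + 1))
      \<and> (\<forall>p. 1 \<le> p \<and> p \<le> N + 1 \<and> (s \<le> m \<longrightarrow> j s < p) \<longrightarrow> 0 \<le> z s p)"
    if "1 \<le> s" "s \<le> m + 1" for s
    using that(2,1)
  proof (induction s rule: inc_induct)
    case base
    then show ?case using ascending_canonical_A[OF x] by (simp add: v_def z_def)
  next
    case (step s)
    have vs: "v s = (h_word N (j s) (i s) @ [Aff (N + 1)]) @ v (Suc s)"
      using step by (simp add: v_def upt_conv_Cons del: upt_Suc)
    have IH: "ascending N (v (Suc s)) (base_window N)"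
      "\<forall>p. 1 \<le> p \<and> p \<le> N + 1 \<and> (Suc s \<le> m \<longrightarrow> p < d (Suc s)) \<longrightarrow> z (Suc s) p < int (N + 1)"
      "\<forall>p. 1 \<le> p \<and> p \<le> N + 1 \<and> (Suc s \<le> m \<longrightarrow> j (Suc s) < p) \<longrightarrow> 0 \<le> z (Suc s) p"
      using step by auto
    have s: "1 \<le> s" "s \<le> m" using step by auto
    have "\<forall>p. 1 \<le> p \<and> p \<le> i s + 1 \<longrightarrow> z (Suc s) p < int (N + 1)"
      using IH(2) nest(1)[OF s(1)] bounds[OF s] by auto
    moreover have "\<forall>p. c s \<le> p \<and> p \<le> N + 1 \<longrightarrow> 0 \<le> z (Suc s) p"
    proof (intro allI impI)
      fix p assume p: "c s \<le> p \<and> p \<le> N + 1"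
      then have "1 \<le> p" using bounds[OF s] by (auto simp: c_def split: if_splits)
      then show "0 \<le> z (Suc s) p" using IH(3) nest(2)[OF s(1)] p by auto
    qed
    moreover have zs: "z s = word_act N (h_word N (j s) (i s) @ [Aff (N + 1)]) (z (Suc s))"
      by (simp add: z_def vs)
    ultimately have
      "ascending N (h_word N (j s) (i s) @ [Aff (N + 1)]) (z (Suc s))"
      "\<forall>p. 1 \<le> p \<and> p < d s \<longrightarrow> z s p < int (N + 1)"
      "\<forall>p. j s < p \<and> p \<le> N + 1 \<longrightarrow> 0 \<le> z s p"
      using block_ascending[OF N bounds[OF s], of "z (Suc s)"] unfolding c_def d_def zs by blast+
    then show ?case using IH(1) s unfolding vs ascending_append[of N "_ @ _"] z_def by auto
  qed
  from this[of 1] show ?thesis by (simp add: v_def canonical_word_def)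
qed

lemma canonical_word_lists:
  assumes "N \<ge> 1" "canonical_form N m j i x"
  shows "canonical_word N m j i x \<in> lists (gens N)"
proof -
  have *: "pairwise_ineqs N m j i" "x \<in> lists (Sigma ` {1..N})"
    using assms canonical_A_lists by (auto simp: canonical_form_def)
  have "h_word N (j s) (i s) @ [Aff (N + 1)] \<in> lists (gens N)" if "s \<in> set [1..<m + 1]" for s
  proof -
    have "1 \<le> s" "s \<le> m" using that by auto
    then have "1 \<le> j s" "i s \<le> N" using pairwise_bounds[OF *(1) assms(1)] by force+
    then show ?thesis using up_lists[of "j s" N N] down_lists[of "i s" N]
      by (simp add: h_word_def gens_def)
  qed
  then have "set (concat (map (\<lambda>s. h_word N (j s) (i s) @ [Aff (N + 1)]) [1..<m + 1])) \<subseteq> gens N"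
    unfolding set_concat set_map lists_eq_set by blast
  moreover have "set x \<subseteq> gens N" using *(2) by (auto simp: gens_def lists_eq_set)
  ultimately show ?thesis by (simp only: canonical_word_def lists_eq_set set_append mem_Collect_eq Un_least)
qed

lemma count_list_eq_0: "a \<notin> set u \<Longrightarrow> count_list u a = 0"
  by (induction u) auto

lemma count_canonical_word:
  assumes "canonical_A N x"
  shows "count_list (canonical_word N m j i x) (Aff (N + 1)) = m"
proof -
  have "count_list (h_word N r k) (Aff (N + 1)) = 0" for r k
    by (rule count_list_eq_0) (auto simp: h_word_def set_up set_down)
  then have "count_list (concat (map (\<lambda>s. h_word N (j s) (i s) @ [Aff (N + 1)]) [1..<m + 1])) (Aff (N + 1)) = m"
    by (induction m) auto
  moreover have "count_list x (Aff (N + 1)) = 0"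
    using canonical_A_lists[OF assms] by (intro count_list_eq_0) auto
  ultimately show ?thesis by (simp add: canonical_word_def)
qed

lemma canonical_word_reduced:
  assumes N: "N \<ge> 1" and form: "canonical_form N m j i x"
  shows "canonical_reduced_expr N m j i x (elt N (canonical_word N m j i x))"
  using ascending_reduced[OF N canonical_word_lists[OF assms] ascending_canonical_word[OF assms]]
    form count_canonical_word[of N x m j i]
  by (simp add: canonical_reduced_expr_def canonical_form_def)

section \<open>Braid moves across a block\<close>

declare cox_eq.trans [trans]

abbreviation eqv :: "nat \<Rightarrow> gen list \<Rightarrow> gen list \<Rightarrow> bool" where
  "eqv n \<equiv> cox_eq (gens n) (cox_mat n)"

lemma eqv_mid:
  assumes "eqv n u v" "a \<in> lists (gens n)" "b \<in> lists (gens n)" "x = a @ u @ b" "y = a @ v @ b"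
  shows "eqv n x y"
  using cox_eq_ctxt[OF assms(1-3)] assms(4,5) by simp

lemma eqv_comm:
  assumes "n \<ge> 2" "s \<in> gens n" "t \<in> gens n" "s \<noteq> t" "\<not> linked n s t"
  shows "eqv n [s, t] [t, s]"
  using elt_comm[OF assms(2,3)] assms elt_eq_iff[of "[s, t]" n "[t, s]"] by (simp add: cox_mat_def)

lemma eqv_braid:
  assumes "n \<ge> 2" "s \<in> gens n" "t \<in> gens n" "s \<noteq> t" "linked n s t"
  shows "eqv n [s, t, s] [t, s, t]"
  using elt_braid[OF assms(2,3)] assms elt_eq_iff[of "[s, t, s]" n "[t, s, t]"]
  by (simp add: cox_mat_def)

lemma eqv_comm_letter:
  assumes n: "n \<ge> 2" and s: "s \<in> gens n"
    and v: "\<forall>t\<in>set v. t \<in> gens n \<and> s \<noteq> t \<and> \<not> linked n s t"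
  shows "eqv n (s # v) (v @ [s])"
  using v
proof (induction v)
  case Nil
  then show ?case using s by (simp add: cox_eq.refl)
next
  case (Cons t v)
  have "eqv n (s # t # v) (t # s # v)"
    by (rule eqv_mid[OF eqv_comm[OF n s, of t], of "[]" v]) (use Cons in auto)
  also have "eqv n (t # s # v) (t # v @ [s])"
    by (rule eqv_mid[OF Cons.IH, of "[t]" "[]"]) (use Cons in auto)
  finally show ?case by simp
qed

text \<open>
  If each letter of a word can be pushed through $v$ at the price of changing into another letter,
  then so can the whole word.
\<close>

lemma eqv_slide:
  assumes "v \<in> lists (gens n)" "f ` set qs \<subseteq> gens n" "g ` set qs \<subseteq> gens n"
    and "\<forall>q\<in>set qs. eqv n (f q # v) (v @ [g q])"
  shows "eqv n (map f qs @ v) (v @ map g qs)"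
  using assms(2-4)
proof (induction qs)
  case Nil
  then show ?case using assms(1) by (simp add: cox_eq.refl)
next
  case (Cons q qs)
  have "eqv n (f q # map f qs @ v) (f q # v @ map g qs)"
    by (rule eqv_mid[OF Cons.IH, of "[f q]" "[]"]) (use Cons in auto)
  also have "eqv n (f q # v @ map g qs) (v @ g q # map g qs)"
    by (rule eqv_mid[of n "f q # v" "v @ [g q]" "[]" "map g qs"]) (use Cons in auto)
  finally show ?case by simp
qed

lemma eqv_comm_words:
  assumes n: "n \<ge> 2" and u: "u \<in> lists (gens n)" and v: "v \<in> lists (gens n)"
    and uv: "\<forall>s\<in>set u. \<forall>t\<in>set v. s \<noteq> t \<and> \<not> linked n s t"
  shows "eqv n (u @ v) (v @ u)"
proof -
  have "\<forall>s\<in>set u. eqv n (s # v) (v @ [s])"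
    using assms by (auto intro!: eqv_comm_letter)
  then show ?thesis
    using eqv_slide[OF v, of "\<lambda>s. s" u "\<lambda>s. s"] u by auto
qed

lemma Sigma_gens: "1 \<le> p \<Longrightarrow> p \<le> n \<Longrightarrow> Sigma p \<in> gens n"
  by (auto simp: gens_def)

lemma linked_Sigma: "linked n (Sigma p) (Sigma q) \<longleftrightarrow>
    (1 \<le> p \<and> p < n \<and> q = p + 1) \<or> (1 \<le> q \<and> q < n \<and> p = q + 1)"
  by (auto simp: linked_def doubleton_eq_iff)

lemma linked_Sigma_Aff: "linked n (Sigma p) (Aff (n + 1)) \<longleftrightarrow> p = n \<or> p = 1"
  by (auto simp: linked_def doubleton_eq_iff)

text \<open>
  In $\sigma_{q+1}\lfloor j,n\rfloor$ the new letter commutes to the factor $\sigma_q\sigma_{q+1}$,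
  where a braid move turns $\sigma_{q+1}\sigma_q\sigma_{q+1}$ into $\sigma_q\sigma_{q+1}\sigma_q$;
  the final $\sigma_q$ commutes with the rest. The lemma on $\lceil i,1\rceil$ below is the mirror
  image.
\<close>

lemma Sigma_up:
  assumes n: "n \<ge> 2" and j: "1 \<le> j" "j \<le> q" and q: "q + 1 \<le> n"
  shows "eqv n (Sigma (q + 1) # up j n) (up j n @ [Sigma q])"
proof -
  have dec: "up j n = up j (q - 1) @ [Sigma q, Sigma (q + 1)] @ up (q + 2) n"
    using up_append[of j "q - 1" n] up_Cons[of q n] up_Cons[of "q + 1" n] j q by simp
  note g = Sigma_gens[of q n] Sigma_gens[of "q + 1" n] up_lists[of j "q - 1" n] up_lists[of "q + 2" n n]
  have "eqv n (Sigma (q + 1) # up j n) (up j (q - 1) @ [Sigma (q + 1), Sigma q, Sigma (q + 1)] @ up (q + 2) n)"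
    unfolding dec
    by (rule eqv_mid[OF eqv_comm_letter[OF n, of "Sigma (q + 1)" "up j (q - 1)"],
          of "[]" "[Sigma q, Sigma (q + 1)] @ up (q + 2) n"])
      (use g j q in \<open>auto simp: set_up linked_Sigma gens_def\<close>)
  also have "eqv n (up j (q - 1) @ [Sigma (q + 1), Sigma q, Sigma (q + 1)] @ up (q + 2) n)
      (up j (q - 1) @ [Sigma q, Sigma (q + 1), Sigma q] @ up (q + 2) n)"
    by (rule eqv_mid[OF eqv_braid[OF n, of "Sigma (q + 1)" "Sigma q"], of "up j (q - 1)" "up (q + 2) n"])
      (use g j q in \<open>auto simp: linked_Sigma\<close>)
  also have "eqv n (up j (q - 1) @ [Sigma q, Sigma (q + 1), Sigma q] @ up (q + 2) n) (up j n @ [Sigma q])"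
    unfolding dec
    by (rule eqv_mid[OF eqv_comm_letter[OF n, of "Sigma q" "up (q + 2) n"],
          of "up j (q - 1) @ [Sigma q, Sigma (q + 1)]" "[]"])
      (use g j q in \<open>auto simp: set_up linked_Sigma gens_def\<close>)
  finally show ?thesis .
qed

lemma Sigma_down:
  assumes n: "n \<ge> 2" and q: "1 \<le> q" "q + 1 \<le> i" and i: "i \<le> n"
  shows "eqv n (Sigma q # down i) (down i @ [Sigma (q + 1)])"
proof -
  define v where "v = map Sigma (rev [q + 2..<i + 1])"
  have dec: "down i = v @ [Sigma (q + 1), Sigma q] @ down (q - 1)"
    using down_split[of "q + 1" i] down_Suc[of q] down_Suc[of "q - 1"] q by (simp add: v_def)
  have v: "v \<in> lists (gens n)" "set v = Sigma ` {q + 2..i}" using i by (auto simp: v_def gens_def)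
  note g = Sigma_gens[of q n] Sigma_gens[of "q + 1" n] down_lists[of "q - 1" n] v
  have "eqv n (Sigma q # down i) (v @ [Sigma q, Sigma (q + 1), Sigma q] @ down (q - 1))"
    unfolding dec
    by (rule eqv_mid[OF eqv_comm_letter[OF n, of "Sigma q" v],
          of "[]" "[Sigma (q + 1), Sigma q] @ down (q - 1)"])
      (use g q i in \<open>auto simp: linked_Sigma gens_def\<close>)
  also have "eqv n (v @ [Sigma q, Sigma (q + 1), Sigma q] @ down (q - 1))
      (v @ [Sigma (q + 1), Sigma q, Sigma (q + 1)] @ down (q - 1))"
    by (rule eqv_mid[OF eqv_braid[OF n, of "Sigma q" "Sigma (q + 1)"], of v "down (q - 1)"])
      (use g q i in \<open>auto simp: linked_Sigma\<close>)
  also have "eqv n (v @ [Sigma (q + 1), Sigma q, Sigma (q + 1)] @ down (q - 1)) (down i @ [Sigma (q + 1)])"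
    unfolding dec
    by (rule eqv_mid[OF eqv_comm_letter[OF n, of "Sigma (q + 1)" "down (q - 1)"],
          of "v @ [Sigma (q + 1), Sigma q]" "[]"])
      (use g q i in \<open>auto simp: set_down linked_Sigma gens_def\<close>)
  finally show ?thesis .
qed

lemma up_shift: "up (p + 1) (l + 1) = map (\<lambda>q. Sigma (q + 1)) [p..<l + 1]"
proof -
  have "[p + 1..<l + 1 + 1] = map Suc [p..<l + 1]" by (simp only: map_Suc_upt Suc_eq_plus1)
  then show ?thesis by (simp add: up_def)
qed

lemma up_up:
  assumes n: "n \<ge> 2" and j: "1 \<le> j" "j \<le> p" "p \<le> n"
  shows "eqv n (up (p + 1) n @ up j n) (up j n @ up p (n - 1))"
proof -
  obtain l where l: "n = l + 1" using n by (cases n) auto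
  have "eqv n (map (\<lambda>q. Sigma (q + 1)) [p..<l + 1] @ up j n) (up j n @ map Sigma [p..<l + 1])"
    by (rule eqv_slide) (use n j l Sigma_up[OF n] up_lists in \<open>auto simp: gens_def\<close>)
  then show ?thesis unfolding l up_shift by (simp add: up_def)
qed

lemma up_down:
  assumes n: "n \<ge> 2" and p: "1 \<le> p" "p \<le> i + 1" and i: "i + 1 \<le> n"
  shows "eqv n (up p i @ down (i + 1)) (down (i + 1) @ up (p + 1) (i + 1))"
proof -
  have "eqv n (map Sigma [p..<i + 1] @ down (i + 1)) (down (i + 1) @ map (\<lambda>q. Sigma (q + 1)) [p..<i + 1])"
  proof (rule eqv_slide)
    show "\<forall>q\<in>set [p..<i + 1]. eqv n (Sigma q # down (i + 1)) (down (i + 1) @ [Sigma (q + 1)])"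
      using Sigma_down[OF n, of _ "i + 1"] p i by auto
  qed (use p i down_lists[of "i + 1" n] in \<open>auto simp: gens_def\<close>)
  then show ?thesis unfolding up_shift by (simp add: up_def)
qed

text \<open>
  Moves common to both cases: $\sigma_n$ joins $\lfloor j,n-1\rfloor$ because it commutes with
  $\lceil i,1\rceil$ for $i\le n-2$, and then the tail $\lfloor p+1,n\rfloor$ passes
  $\lfloor j,n\rfloor$ with its indices lowered by one.
\<close>

lemma block_head:
  assumes n: "n \<ge> 2" and j: "1 \<le> j" "j \<le> p" "p \<le> n" and i: "i + 2 \<le> n"
  shows "eqv n (up (p + 1) n @ h_word (n - 1) j i @ [Sigma n, Aff (n + 1), Sigma n])
    (up j n @ up p (n - 1) @ down i @ [Aff (n + 1), Sigma n])"
proof -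
  have last: "up j (n - 1) @ [Sigma n] = up j n"
    using up_append[of j "n - 1" n] up_Cons[of n n] up_empty[of n "n + 1"] n j by simp
  have a: "Aff (n + 1) \<in> gens n" by (simp add: gens_def)
  note g = a Sigma_gens[of n n] up_lists[of "p + 1" n n] up_lists[of j n n] up_lists[of j "n - 1" n]
    down_lists[of i n]
  have "eqv n (up (p + 1) n @ h_word (n - 1) j i @ [Sigma n, Aff (n + 1), Sigma n])
      (up (p + 1) n @ up j n @ down i @ [Aff (n + 1), Sigma n])"
    by (rule eqv_mid[OF eqv_comm_words[OF n, of "down i" "[Sigma n]"],
          of "up (p + 1) n @ up j (n - 1)" "[Aff (n + 1), Sigma n]"])
      (use g n i j in \<open>auto simp: set_down linked_Sigma h_word_def last[symmetric]\<close>)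
  also have "eqv n (up (p + 1) n @ up j n @ down i @ [Aff (n + 1), Sigma n])
      (up j n @ up p (n - 1) @ down i @ [Aff (n + 1), Sigma n])"
    by (rule eqv_mid[OF up_up[OF n j], of "[]" "down i @ [Aff (n + 1), Sigma n]"])
      (use g n i in auto)
  finally show ?thesis .
qed

text \<open>
  All indices of $\lfloor p,n-1\rfloor$ lie between $i+2$ and $n-1$, so this word commutes with
  $\lceil i,1\rceil$ and, not containing $\sigma_1$ or $\sigma_n$, with $a_{n+1}$. It then absorbs
  the trailing $\sigma_n$.
\<close>

lemma block_low:
  assumes n: "n \<ge> 2" and j: "1 \<le> j" "j \<le> p" "p \<le> n" and i: "i + 2 \<le> p"
  shows "eqv n (up (p + 1) n @ h_word (n - 1) j i @ [Sigma n, Aff (n + 1), Sigma n])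
    (h_word n j i @ [Aff (n + 1)] @ up p n)"
proof -
  have last: "up p (n - 1) @ [Sigma n] = up p n"
    using up_append[of p "n - 1" n] up_Cons[of n n] up_empty[of n "n + 1"] n j by simp
  have a: "Aff (n + 1) \<in> gens n" by (simp add: gens_def)
  note g = a Sigma_gens[of n n] up_lists[of j n n] up_lists[of p "n - 1" n] down_lists[of i n]
  note block_head[OF n j, of i]
  also have "eqv n (up j n @ up p (n - 1) @ down i @ [Aff (n + 1), Sigma n])
      (h_word n j i @ [Aff (n + 1)] @ up p n)"
    by (rule eqv_mid[OF eqv_comm_words[OF n, of "up p (n - 1)" "down i @ [Aff (n + 1)]"],
          of "up j n" "[Sigma n]"])
      (use g n i j in \<open>auto simp: set_down set_up linked_Sigma linked_Sigma_Aff[simplified] h_word_def last[symmetric]\<close>)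
  finally show ?thesis using i j by simp
qed

text \<open>
  Now $\sigma_{i+1}$ occurs in $\lfloor p,n-1\rfloor$ and completes $\lceil i,1\rceil$ to
  $\lceil i+1,1\rceil$. The letters before it pass $\lceil i+1,1\rceil$ with their indices raised by
  one and close the gap at $i+1$, leaving $\lfloor p+1,n-1\rfloor$, which commutes with $a_{n+1}$
  because $p\ge 1$.
\<close>

lemma block_high:
  assumes n: "n \<ge> 2" and j: "1 \<le> j" "j \<le> p" and p: "p \<le> i + 1" and i: "i + 2 \<le> n"
  shows "eqv n (up (p + 1) n @ h_word (n - 1) j i @ [Sigma n, Aff (n + 1), Sigma n])
    (h_word n j (i + 1) @ [Aff (n + 1)] @ up (p + 1) n)"
proof -
  let ?a = "Aff (n + 1)"
  have a: "?a \<in> gens n" by (simp add: gens_def)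
  note g = a Sigma_gens[of n n] up_lists[of j n n] up_lists[of p i n] up_lists[of "i + 2" "n - 1" n]
    up_lists[of "p + 1" "i + 1" n] up_lists[of "p + 1" "n - 1" n]
    down_lists[of i n] down_lists[of "i + 1" n] Sigma_gens[of "i + 1" n]
  have mid: "up p (n - 1) = up p i @ [Sigma (i + 1)] @ up (i + 2) (n - 1)"
    using up_append[of p i "n - 1"] up_Cons[of "i + 1" "n - 1"] p i by simp
  have join: "up (p + 1) (i + 1) @ up (i + 2) (n - 1) = up (p + 1) (n - 1)"
    using up_append[of "p + 1" "i + 1" "n - 1"] p i by simp
  have last: "up (p + 1) (n - 1) @ [Sigma n] = up (p + 1) n"
    using up_append[of "p + 1" "n - 1" n] up_Cons[of n n] up_empty[of n "n + 1"] n p i by simp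
  have "eqv n (up (p + 1) n @ h_word (n - 1) j i @ [Sigma n, ?a, Sigma n])
      (up j n @ up p (n - 1) @ down i @ [?a, Sigma n])"
    using block_head[OF n j, of i] p i by simp
  also have "eqv n (up j n @ up p (n - 1) @ down i @ [?a, Sigma n])
      (up j n @ up p i @ down (i + 1) @ up (i + 2) (n - 1) @ [?a, Sigma n])"
    unfolding mid
    by (rule eqv_mid[OF eqv_comm_words[OF n, of "up (i + 2) (n - 1)" "down i"],
          of "up j n @ up p i @ [Sigma (i + 1)]" "[?a, Sigma n]"])
      (use g n i j p in \<open>auto simp: set_down set_up linked_Sigma down_Suc\<close>)
  also have "eqv n (up j n @ up p i @ down (i + 1) @ up (i + 2) (n - 1) @ [?a, Sigma n])
      (up j n @ down (i + 1) @ up (p + 1) (n - 1) @ [?a, Sigma n])"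
    unfolding join[symmetric]
    by (rule eqv_mid[OF up_down[OF n, of p i], of "up j n" "up (i + 2) (n - 1) @ [?a, Sigma n]"])
      (use g n i j p in auto)
  also have "eqv n (up j n @ down (i + 1) @ up (p + 1) (n - 1) @ [?a, Sigma n])
      (h_word n j (i + 1) @ [?a] @ up (p + 1) n)"
    unfolding last[symmetric]
    by (rule eqv_mid[OF eqv_comm_words[OF n, of "up (p + 1) (n - 1)" "[?a]"],
          of "up j n @ down (i + 1)" "[Sigma n]"])
      (use g n i j p in \<open>auto simp: set_up linked_Sigma_Aff[simplified] h_word_def\<close>)
  finally show ?thesis .
qed

section \<open>The canonical word of the image\<close>

text \<open>
  After $k$ blocks the tail is $\lfloor n-\min(k,s)+1,n\rfloor$, and moving it past
  $\lfloor j_{k+1},n\rfloor$ requires $j_{k+1}\le n-\min(k,s)$. While the tail grows, either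
  $j_k>i_k+1$ and $j$ drops strictly, or $j_{k+1}\le j_k\le i_k+1\le n-k$.
\<close>

lemma rows_below_tail:
  assumes n: "n \<ge> 2" and pw: "pairwise_ineqs (n - 1) m j i"
    and low: "\<And>k. 1 \<le> k \<Longrightarrow> k \<le> s \<Longrightarrow> k + i k < n"
    and k: "Suc k \<le> m"
  shows "j (Suc k) + min k s \<le> n"
  using k
proof (induction k)
  case 0
  then show ?case using pairwise_bounds(2)[OF pw, of 1] n by simp
next
  case (Suc k)
  then have IH: "j (Suc k) + min k s \<le> n" by simp
  note st = pairwise_step[OF pw, of "Suc k"]
  show ?case
  proof (cases "Suc k \<le> s \<and> j (Suc k) \<le> i (Suc k) + 1")
    case True
    then show ?thesis using low[of "Suc k"] st(1) Suc.prems by simp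
  next
    case False
    then show ?thesis using IH st(1,3) Suc.prems by (auto simp: min_def split: if_splits)
  qed
qed

text \<open>
  The braid moves replace letters in equal number, which gives the equality of lengths needed to
  conclude that the substituted word is reduced.
\<close>

lemma blocks_slide:
  assumes n: "n \<ge> 2" and pw: "pairwise_ineqs (n - 1) m j i"
    and low: "\<And>k. 1 \<le> k \<Longrightarrow> k \<le> s \<Longrightarrow> k + i k < n"
    and high: "\<And>k. s < k \<Longrightarrow> k \<le> m \<Longrightarrow> n \<le> s + 1 + i k"
    and i': "i' = (\<lambda>k. if k \<le> s then i k else i k + 1)"
    and k: "k \<le> m"
  defines "B \<equiv> \<lambda>k. h_word (n - 1) (j k) (i k) @ [Sigma n, Aff (n + 1), Sigma n]"
    and "B' \<equiv> \<lambda>k. h_word n (j k) (i' k) @ [Aff (n + 1)]"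
  shows "eqv n (concat (map B [1..<k + 1])) (concat (map B' [1..<k + 1]) @ up (n - min k s + 1) n)"
    and "length (concat (map B [1..<k + 1]))
      = length (concat (map B' [1..<k + 1]) @ up (n - min k s + 1) n)"
proof -
  have "eqv n (concat (map B [1..<k + 1])) (concat (map B' [1..<k + 1]) @ up (n - min k s + 1) n)
    \<and> length (concat (map B [1..<k + 1]))
      = length (concat (map B' [1..<k + 1]) @ up (n - min k s + 1) n)"
    using k
  proof (induction k)
    case 0
    then show ?case by (simp add: up_empty cox_eq.refl)
  next
    case (Suc k)
    have N: "n - 1 \<ge> 1" using n by simp
    define p where "p = n - min k s"
    define C where "C = concat (map B [1..<k + 1])"
    define C' where "C' = concat (map B' [1..<k + 1])"
    have IH: "eqv n C (C' @ up (p + 1) n)" "length C = length (C' @ up (p + 1) n)"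
      using Suc by (auto simp: C_def C'_def p_def)
    have C_Suc: "concat (map B [1..<Suc k + 1]) = C @ B (Suc k)"
      "concat (map B' [1..<Suc k + 1]) = C' @ B' (Suc k)"
      by (simp_all add: C_def C'_def)
    have j: "1 \<le> j (Suc k)" and i: "i (Suc k) + 2 \<le> n"
      using pairwise_bounds[OF pw N, of "Suc k"] Suc.prems by auto
    have jp: "j (Suc k) \<le> p" using rows_below_tail[OF n pw _ Suc.prems, of s] low by (auto simp: p_def)
    have p: "p \<le> n" by (simp add: p_def)
    define p' where "p' = n - min (Suc k) s + 1"
    have step: "eqv n (up (p + 1) n @ B (Suc k)) (B' (Suc k) @ up p' n)
      \<and> length (up (p + 1) n @ B (Suc k)) = length (B' (Suc k) @ up p' n)"
    proof (cases "Suc k \<le> s")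
      case True
      then have "i (Suc k) + 2 \<le> p" "p' = p" "i' (Suc k) = i (Suc k)"
        using low[of "Suc k"] by (auto simp: p_def p'_def i')
      then show ?thesis
        using block_low[OF n j jp p, of "i (Suc k)"] j jp p n
        by (auto simp: B_def B'_def h_word_def length_up length_down)
    next
      case False
      then have "p \<le> i (Suc k) + 1" "p' = p + 1" "i' (Suc k) = i (Suc k) + 1"
        using high[of "Suc k"] Suc.prems by (auto simp: p_def p'_def i')
      then show ?thesis
        using block_high[OF n j jp, of "i (Suc k)"] i j jp p n
        by (auto simp: B_def B'_def h_word_def length_up length_down)
    qed
    have l: "C' \<in> lists (gens n)" "B (Suc k) \<in> lists (gens n)"
      using cox_eq_lists[OF IH(1)] cox_eq_lists[OF conjunct1[OF step]] by auto
    have "eqv n (C @ B (Suc k)) (C' @ up (p + 1) n @ B (Suc k))"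
      by (rule eqv_mid[OF IH(1), of "[]" "B (Suc k)"]) (use l in auto)
    also have "eqv n (C' @ up (p + 1) n @ B (Suc k)) (C' @ B' (Suc k) @ up p' n)"
      by (rule eqv_mid[OF conjunct1[OF step], of C' "[]"]) (use l in auto)
    finally have "eqv n (C @ B (Suc k)) (C' @ B' (Suc k) @ up p' n)" .
    moreover have "length (C @ B (Suc k)) = length (C' @ B' (Suc k) @ up p' n)"
      using IH(2) step by simp
    ultimately show ?case unfolding C_Suc p'_def by simp
  qed
  then show "eqv n (concat (map B [1..<k + 1])) (concat (map B' [1..<k + 1]) @ up (n - min k s + 1) n)"
    and "length (concat (map B [1..<k + 1]))
      = length (concat (map B' [1..<k + 1]) @ up (n - min k s + 1) n)"
    by blast+
qed

text \<open>
  All factors of $x$ end at most at $N$, so one more factor ending at $N+1$ can be put in front.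
\<close>

lemma canonical_A_Cons:
  assumes x: "canonical_A N x" and t: "1 \<le> t" "t \<le> N + 1"
  shows "canonical_A (N + 1) (up t (N + 1) @ x)"
proof -
  obtain T k l where kl: "\<forall>p\<in>{1..T}. 1 \<le> k p \<and> k p \<le> l p \<and> l p \<le> N"
    and dec: "\<forall>p\<in>{1..<T}. l p > l (p + 1)"
    and x: "x = concat (map (\<lambda>p. up (k p) (l p)) [1..<T + 1])"
    using x unfolding canonical_A_def by blast
  define k' where "k' p = (if p = 1 then t else k (p - 1))" for p
  define l' where "l' p = (if p = 1 then N + 1 else l (p - 1))" for p
  have "1 \<le> k' p \<and> k' p \<le> l' p \<and> l' p \<le> N + 1" if "p \<in> {1..T + 1}" for p
  proof (cases "p = 1")
    case False
    then have "p - 1 \<in> {1..T}" using that by auto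
    then show ?thesis using kl[THEN bspec, of "p - 1"] False by (auto simp: k'_def l'_def)
  qed (use t in \<open>simp add: k'_def l'_def\<close>)
  moreover have "l' p > l' (p + 1)" if "p \<in> {1..<T + 1}" for p
  proof (cases "p = 1")
    case True
    then show ?thesis using that kl[THEN bspec, of 1] by (auto simp: l'_def)
  next
    case False
    then have "p - 1 \<in> {1..<T}" using that by auto
    then show ?thesis using dec[THEN bspec, of "p - 1"] False by (auto simp: l'_def)
  qed
  moreover have "up t (N + 1) @ x = concat (map (\<lambda>p. up (k' p) (l' p)) [1..<T + 1 + 1])"
  proof -
    have "[1..<T + 1 + 1] = 1 # map Suc [1..<T + 1]"
      unfolding map_Suc_upt by (simp add: upt_conv_Cons del: upt_Suc)
    then have "concat (map (\<lambda>p. up (k' p) (l' p)) [1..<T + 1 + 1])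
        = up t (N + 1) @ concat (map (\<lambda>p. up (k' (Suc p)) (l' (Suc p))) [1..<T + 1])"
      by (simp add: k'_def l'_def comp_def del: upt_Suc)
    also have "map (\<lambda>p. up (k' (Suc p)) (l' (Suc p))) [1..<T + 1] = map (\<lambda>p. up (k p) (l p)) [1..<T + 1]"
      by (rule map_cong) (auto simp: k'_def l'_def)
    finally show ?thesis by (simp add: x)
  qed
  ultimately show ?thesis unfolding canonical_A_def by blast
qed

text \<open>
  Raising $i_k$ for all $k>s$ keeps $i$ weakly increasing, preserves strict increases and
  makes the premises $j_k>i_k+1$ of the two strictness conditions harder to satisfy; it raises the upper bound by one, as the
  rank does.
\<close>

lemma pairwise_ineqs_image:
  assumes n: "n \<ge> 2" and pw: "pairwise_ineqs (n - 1) m j i" and s: "1 \<le> s"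
    and i': "i' = (\<lambda>k. if k \<le> s then i k else i k + 1)"
  shows "pairwise_ineqs n m j i'"
  unfolding pairwise_ineqs_def
proof (intro conjI ballI)
  have 1: "1 \<le> j 1" "j 1 \<le> n" "i 1 + 2 \<le> n" using pw n unfolding pairwise_ineqs_def by auto
  then show "1 \<le> j 1" "j 1 \<le> n + 1" "i' 1 + 1 \<le> n" using s by (auto simp: i')
  fix k assume k: "k \<in> {2..m}"
  then obtain l where l: "k = Suc l" "1 \<le> l" "Suc l \<le> m" by (cases k) auto
  note st = pairwise_step[OF pw l(2,3)]
  have "(i k = 0 \<and> j k = 1) \<or> (1 \<le> i k \<and> i k + 1 \<le> n - 1 \<and> 1 \<le> j k \<and> j k \<le> n - 1)"
    using pw k unfolding pairwise_ineqs_def by blast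
  then show "(i' k = 0 \<and> j k = 1) \<or> (1 \<le> i' k \<and> i' k + 1 \<le> n \<and> 1 \<le> j k \<and> j k \<le> n)"
    using n by (auto simp: i')
  show "j k \<le> j (k - 1)" "i' (k - 1) \<le> i' k" using st l by (auto simp: i')
  show "i' (k - 1) + 1 < j (k - 1) \<longrightarrow> j k < j (k - 1)" using st l by (auto simp: i')
  show "i' k + 1 < j k \<longrightarrow> i' (k - 1) < i' k" using st l by (auto simp: i')
qed

lemma length_subst_aff: "length (subst_aff n u) = length u + 2 * count_list u (Aff n)"
  by (induction u) (auto simp: subst_aff_def)

lemma subst_aff_Sigma:
  assumes "u \<in> lists (range Sigma)"
  shows "subst_aff n u = u"
  using assms by (induction u) (auto simp: subst_aff_def)

lemma subst_aff_canonical_word: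
  assumes n: "n \<ge> 2" and x: "canonical_A (n - 1) x"
  shows "subst_aff n (canonical_word (n - 1) m j i x)
    = concat (map (\<lambda>k. h_word (n - 1) (j k) (i k) @ [Sigma n, Aff (n + 1), Sigma n]) [1..<m + 1]) @ x"
proof -
  have "h_word N r k \<in> lists (range Sigma)" for N r k
    by (auto simp: h_word_def set_up set_down)
  then have "subst_aff n (h_word (n - 1) r k @ [Aff n]) = h_word (n - 1) r k @ [Sigma n, Aff (n + 1), Sigma n]"
    for r k by (simp add: subst_aff_append subst_aff_Sigma) (simp add: subst_aff_def)
  then have "subst_aff n (concat (map (\<lambda>k. h_word (n - 1) (j k) (i k) @ [Aff n]) ks))
    = concat (map (\<lambda>k. h_word (n - 1) (j k) (i k) @ [Sigma n, Aff (n + 1), Sigma n]) ks)" for ks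
    by (induction ks) (simp_all add: subst_aff_append[of n "_ @ _", simplified] subst_aff_def)
  moreover have "subst_aff n x = x"
    using canonical_A_lists[OF x] by (intro subst_aff_Sigma) auto
  moreover have "n - 1 + 1 = n" using n by simp
  ultimately show ?thesis by (simp only: canonical_word_def subst_aff_append)
qed

theorem theorem4p6:
  fixes n m :: nat and j i i' :: "nat \<Rightarrow> nat" and s t :: nat
    and x :: "gen list" and w :: "gen list set"
  assumes "n \<ge> 2" and "m \<ge> 1"
    and "canonical_form (n - 1) m j i x"
    and "expression (n - 1) (canonical_word (n - 1) m j i x) w"
    and "s = Max {k. 1 \<le> k \<and> k \<le> m \<and> int n - int k - int (i k) > 0}"
    and "i' = (\<lambda>k. if k \<le> s then i k else i k + 1)"
    and "t = n - s + 1"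
  shows "reduced_expr n (subst_aff n (canonical_word (n - 1) m j i x)) (R_map n w)
    \<and> canonical_reduced_expr n m j i' (up t n @ x) (R_map n w)
    \<and> affine_length n (R_map n w) = affine_length (n - 1) w
    \<and> len n (R_map n w) = len (n - 1) w + 2 * affine_length (n - 1) w
    \<and> (\<forall>u. reduced_expr (n - 1) u w \<longrightarrow>
          (reduced_expr n (subst_aff n u) (R_map n w) \<longleftrightarrow> affine_length_reduced_expr (n - 1) u w))"
proof -
  note n = assms(1) and form = assms(3) and i' = assms(6)
  have pw: "pairwise_ineqs (n - 1) m j i" and x: "canonical_A (n - 1) x"
    using form by (auto simp: canonical_form_def)
  define K where "K = {k. 1 \<le> k \<and> k \<le> m \<and> k + i k < n}"
  have "{k. 1 \<le> k \<and> k \<le> m \<and> int n - int k - int (i k) > 0} = K" by (auto simp: K_def)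
  then have s_Max: "s = Max K" using assms(5) by simp
  have "n - 1 \<ge> 1" using n by simp
  then have K: "finite K" "1 \<in> K"
    using pairwise_bounds(3)[OF pw, of 1] assms(2) by (auto simp: K_def)
  then have "s \<in> K" using Max_in[OF K(1)] s_Max by blast
  then have s: "1 \<le> s" "s \<le> m" "s + i s < n" by (auto simp: K_def)
  \<comment> \<open>As \<open>i\<close> is weakly increasing, \<open>K\<close> is the whole of \<open>{1..s}\<close>, and \<open>n \<le> k + i k\<close> beyond it.\<close>
  have low: "k + i k < n" if "1 \<le> k" "k \<le> s" for k
    using pairwise_mono[OF pw that s(2)] that s(3) by simp
  have high: "n \<le> s + 1 + i k" if "s < k" "k \<le> m" for k
  proof -
    have "Suc s \<notin> K" using Max_ge[OF K(1), of "Suc s"] s_Max by auto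
    then have "n \<le> Suc s + i (Suc s)" using that by (auto simp: K_def)
    moreover have "i (Suc s) \<le> i k" using pairwise_mono[OF pw, of "Suc s" k] that by simp
    ultimately show ?thesis by simp
  qed
  let ?W = "canonical_word (n - 1) m j i x" and ?W' = "canonical_word n m j i' (up t n @ x)"
  have form': "canonical_form n m j i' (up t n @ x)"
    using pairwise_ineqs_image[OF n pw s(1) i'] canonical_A_Cons[OF x, of t] n s assms(2,7)
    by (simp add: canonical_form_def)
  have t: "t = n - min m s + 1" using s assms(7) by simp
  note slide = blocks_slide[OF n pw low high i' order_refl, folded t]
  have "Sigma ` {1..n - 1} \<subseteq> gens n" by (auto simp: gens_def)
  then have xl: "x \<in> lists (gens n)" using canonical_A_lists[OF x] lists_mono by blast
  have moved: "eqv n (subst_aff n ?W) ?W'" "length (subst_aff n ?W) = length ?W'"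
    using eqv_mid[OF slide(1), of "[]" x] slide(2) xl
    unfolding subst_aff_canonical_word[OF n x] by (auto simp: canonical_word_def)
  have w: "?W \<in> lists (gens (n - 1))" "w = elt (n - 1) ?W"
    using assms(4) by (auto simp: expression_def)
  have "canonical_reduced_expr (n - 1) m j i x w"
    using canonical_word_reduced[OF _ form] n w(2) by simp
  then have src: "len (n - 1) w = length ?W" "affine_length (n - 1) w = m"
    by (auto simp: canonical_reduced_expr_def reduced_expr_def)
  have R: "R_map n (elt (n - 1) u) = elt n (subst_aff n u)" if "u \<in> lists (gens (n - 1))" for u
    using R_map_elt[OF n that] .
  have img: "R_map n w = elt n ?W'"
    using R[OF w(1)] w(2) moved(1) elt_eq_iff subst_aff_lists[OF n w(1)] by simp
  have can: "canonical_reduced_expr n m j i' (up t n @ x) (R_map n w)"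
    using canonical_word_reduced[OF _ form'] n img by simp
  have "count_list ?W (Aff n) = m"
    using count_canonical_word[OF x, of m j i] n by simp
  then have len: "affine_length n (R_map n w) = m" "len n (R_map n w) = length ?W + 2 * m"
    using can moved(2) length_subst_aff[of n ?W]
    by (auto simp: canonical_reduced_expr_def reduced_expr_def)
  have subst: "reduced_expr n (subst_aff n u) (R_map n w)
      \<longleftrightarrow> length u + 2 * count_list u (Aff n) = length ?W + 2 * m"
    if "expression (n - 1) u w" for u
    using that R[of u] subst_aff_lists[OF n, of u] len(2)
    by (auto simp: reduced_expr_def expression_def length_subst_aff)
  have "affine_length_reduced_expr (n - 1) u w \<longleftrightarrow> count_list u (Aff n) = m"
    "length u = length ?W" if "reduced_expr (n - 1) u w" for u
    using that src n by (auto simp: affine_length_reduced_expr_def reduced_expr_def)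
  then have "reduced_expr n (subst_aff n u) (R_map n w) \<longleftrightarrow> affine_length_reduced_expr (n - 1) u w"
    if "reduced_expr (n - 1) u w" for u
    using that subst[of u] by (auto simp: reduced_expr_def)
  moreover have "reduced_expr n (subst_aff n ?W) (R_map n w)"
    using subst[OF assms(4)] \<open>count_list ?W (Aff n) = m\<close> by simp
  ultimately show ?thesis using can len src by simp
qed

end
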